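(* Let $\mathcal{K}$ be a Morse projection of an oriented link, with part arc-graph $P\mathcal{K}$ and arc-graphs $G_{+}\mathcal{K}$ (built from overcrossing arcs) and $G_{-}\mathcal{K}$ (built from undercrossing arcs). Then for each sign $\pm$ there is a natural bijection $\phi_{\pm}$ from the set of $\mathbb{Z}$-flows on $G_{\pm}\mathcal{K}$ to the set of $\mathbb{Z}$-flows on $P\mathcal{K}$. For the sign $+$, $\phi_+$ is characterized as follows: the color of the blue edge $e_v^b$ of $G_+\mathcal{K}$ is the color of the part arc of $P\mathcal{K}$ leaving the crossing $v$ on the understrand (the part arc following the transition), and the color of the red edge $e_v^r$ is the change of the color at the crossing $v$ (the color of the overstrand increases by $f(e_v^r)$ and the color of the understrand decreases by $f(e_v^r)$ when passing through $v$). For each integer $n\geq 1$ and each sign, $\phi_\pm$ restricts to a bijection $$\phi_{\pm}:\ \mathcal{F}_n(G_{\pm}\mathcal{K})\longrightarrow \mathcal{F}^n_{\pm}(P\mathcal{K}).$$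
   Context: Put $\underline{n}=\{0,1,\ldots,n\}$ in this statement. Projection and part arc-graph. $\mathcal{K}$ is a generic (transverse double points) immersed oriented planar link diagram, such that the height function is Morse on it. $P\mathcal{K}$ is the 4-valent planar digraph whose vertices are the crossings and whose edges are the part arcs (the pieces of $\mathcal{K}$ between consecutive passages through crossings, oriented as $\mathcal{K}$; a component without crossings is a single closed part arc, which also gets a color). A $\mathbb{Z}$-flow on $P\mathcal{K}$ is a function from part arcs to $\mathbb{Z}$ such that at every crossing the sum of the two incoming colors equals the sum of the two outgoing colors. $\mathcal{F}^n_{+}(P\mathcal{K})$ (respectively $\mathcal{F}^n_{-}(P\mathcal{K})$) is the set of $\mathbb{Z}$-flows with all colors in $\underline{n}$ such that at every crossing the color weakly increases (respectively weakly decreases) along the overstrand in the direction of the orientation (hence weakly decreases, respectively increases, along the understrand). Arc-graph $G_+\mathcal{K}$. An overcrossing arc is a maximal piece of $\mathcal{K}$ which starts at an undercrossing and ends at the next undercrossing along the orientation; an overcrossing circle is a component of $\mathcal{K}$ with no undercrossings. The vertices of $G_+\mathcal{K}$ are the overcrossing arcs and the overcrossing circles. Each overcrossing arc is identified with the crossing $v$ at which it ends (as an understrand). Each overcrossing arc $v$ has exactly two outgoing edges: a blue edge $e_v^b$ to the overcrossing arc that starts at the crossing $v$, and a red edge $e_v^r$ to the overcrossing arc or circle which passes over at the crossing $v$. Overcrossing circles have no outgoing edges and no incoming blue edges. The incoming edges at an overcrossing arc $u$ are ordered by position along $u$, the incoming blue edge being first; the incoming red edges at a circle are cyclically ordered in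 the same way. Flows on $G_+\mathcal{K}$. A $\mathbb{Z}$-flow $f$ assigns an integer to each blue and red edge and, for each overcrossing circle, an integer to one chosen part arc of that circle (the whole circle if it has no crossings), such that: at each overcrossing arc $v$, the sum of the colors of the incoming edges equals $f(v):=f(e_v^b)+f(e_v^r)$; at each overcrossing circle the sum of the colors of the incoming red edges is $0$; and for each link component the sum of colors of the red edges entering the vertices of this component minus the sum of colors of the red edges leaving these vertices is $0$. $\mathcal{F}_n(G_+\mathcal{K})$ is the set of $\mathbb{Z}$-flows all of whose values (including those assigned to circles) lie in $\underline{n}$ and with $f(v)\le n$ for each overcrossing arc $v$. The map $\phi_+$ sends the value assigned to the chosen part arc of an overcrossing circle to the color of that part arc. $G_-\mathcal{K}$, its flows, $\mathcal{F}_n(G_-\mathcal{K})$ and $\phi_-$ are defined in the same way with the roles of over and under exchanged: vertices are undercrossing arcs (pieces from one overcrossing to the next one) and undercrossing circles; an undercrossing arc is identified with the crossing $v$ at which it ends as an overstrand; $e_v^b$ leads to the undercrossing arc starting at $v$, and $e_v^r$ to the undercrossing arc or circle passing under at $v$; $f(e_v^b)$ is the color of the part arc leaving $v$ on the overstrand and $f(e_v^r)$ is the decrease of the color along the overstrand (the increase along the understrand) at $v$. *)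

theory Defs
  imports "HOL-Analysis.Analysis" "Graph_Theory.Digraph"
begin

section \<open>Link diagrams in the plane\<close>

text \<open>
  The plane is \<^typ>\<open>complex\<close>, the height function is \<^const>\<open>Im\<close>.
  The components are numbered \<open>0, ..., ncomp K - 1\<close>; component \<open>i\<close> is the closed curve
  \<open>curve K i\<close> of period 1, oriented by increasing parameter. A point of the source
  (a disjoint union of circles) is a pair \<open>(i, t)\<close> with \<open>0 \<le> t < 1\<close>.
  The crossing information is the set \<open>over K\<close> of those source points at which
  the diagram passes over a crossing.
\<close>

type_synonym point = "nat \<times> real"

record diagram =
  ncomp :: nat
  curve :: "nat \<Rightarrow> real \<Rightarrow> complex"
  over :: "point set"

definition source :: "diagram \<Rightarrow> point set" where
  "source K = {..<ncomp K} \<times> {0..<1}"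

definition pt :: "diagram \<Rightarrow> point \<Rightarrow> complex" where
  "pt K p = curve K (fst p) (snd p)"

definition velocity :: "diagram \<Rightarrow> nat \<Rightarrow> real \<Rightarrow> complex" where
  "velocity K i t = vector_derivative (curve K i) (at t)"

definition acceleration :: "diagram \<Rightarrow> nat \<Rightarrow> real \<Rightarrow> complex" where
  "acceleration K i t = vector_derivative (velocity K i) (at t)"

definition smooth_curve :: "(real \<Rightarrow> complex) \<Rightarrow> bool" where
  "smooth_curve \<gamma> \<longleftrightarrow>
     (\<exists>D. D 0 = \<gamma> \<and> (\<forall>k t. (D k has_vector_derivative D (Suc k) t) (at t)))"

definition passages :: "diagram \<Rightarrow> point set" where
  "passages K = {p \<in> source K. \<exists>q\<in>source K. q \<noteq> p \<and> pt K q = pt K p}"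

definition under :: "diagram \<Rightarrow> point set" where
  "under K = passages K - over K"

definition crossings :: "diagram \<Rightarrow> complex set" where
  "crossings K = pt K ` passages K"

definition immersed :: "diagram \<Rightarrow> bool" where
  "immersed K \<longleftrightarrow>
     (\<forall>i<ncomp K. smooth_curve (curve K i) \<and>
        (\<forall>t. curve K i (t + 1) = curve K i t) \<and> (\<forall>t. velocity K i t \<noteq> 0))"

text \<open>At most double points, all of them transverse: the velocities \<open>a\<close>, \<open>b\<close> of the two
  strands are linearly independent over the reals, i.e. \<open>det (a, b) = Im (cnj a * b) \<noteq> 0\<close>.\<close>

definition generic :: "diagram \<Rightarrow> bool" where
  "generic K \<longleftrightarrow>
     (\<forall>p\<in>source K. \<forall>q\<in>source K. p \<noteq> q \<and> pt K p = pt K q \<longrightarrow>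
        Im (cnj (velocity K (fst p) (snd p)) * velocity K (fst q) (snd q)) \<noteq> 0) \<and>
     (\<forall>p\<in>source K. \<forall>q\<in>source K. \<forall>r\<in>source K.
        pt K p = pt K q \<and> pt K q = pt K r \<longrightarrow> p = q \<or> q = r \<or> p = r)"

definition height_Morse :: "diagram \<Rightarrow> bool" where
  "height_Morse K \<longleftrightarrow>
     (\<forall>i<ncomp K. \<forall>t. Im (velocity K i t) = 0 \<longrightarrow> Im (acceleration K i t) \<noteq> 0)"

definition crossing_info :: "diagram \<Rightarrow> bool" where
  "crossing_info K \<longleftrightarrow>
     over K \<subseteq> passages K \<and> (\<forall>v\<in>crossings K. \<exists>!p. p \<in> over K \<and> pt K p = v)"

definition Morse_projection :: "diagram \<Rightarrow> bool" where
  "Morse_projection K \<longleftrightarrow> immersed K \<and> generic K \<and> height_Morse K \<and> crossing_info K"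


section \<open>Pieces of a diagram\<close>

text \<open>
  Cutting the source circles at a set \<open>S\<close> of passages gives arcs \<open>Arc p q\<close>, running
  from \<open>p\<close> in \<open>S\<close> to the next element \<open>q\<close> of \<open>S\<close> along the
  orientation (\<open>q = p\<close> if \<open>p\<close> is the only element of \<open>S\<close> on its circle), and
  a \<open>Circle i\<close> for each component \<open>i\<close> without elements of \<open>S\<close>. Part arcs, overcrossing
  arcs and undercrossing arcs arise for \<open>S\<close> the set of all passages, of the
  underpassages and of the overpassages.
\<close>

datatype piece = Arc (start: point) (stop: point) | Circle nat

fun component :: "piece \<Rightarrow> nat" where
  "component (Arc p q) = fst p"
| "component (Circle i) = i"

text \<open>The time in \<open>(0, 1]\<close> needed to go from \<open>t\<close> to \<open>u\<close> on the circle of length 1, where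
  going from \<open>t\<close> to itself means a full turn.\<close>

definition advance :: "real \<Rightarrow> real \<Rightarrow> real" where
  "advance t u = (if t < u then u - t else u - t + 1)"

definition next_in :: "point set \<Rightarrow> point \<Rightarrow> point" where
  "next_in S p = (fst p, ARG_MIN (\<lambda>u. advance (snd p) u) u. (fst p, u) \<in> S)"

definition prev_in :: "point set \<Rightarrow> point \<Rightarrow> point" where
  "prev_in S p = (fst p, ARG_MIN (\<lambda>u. advance u (snd p)) u. (fst p, u) \<in> S)"

definition pieces :: "diagram \<Rightarrow> point set \<Rightarrow> piece set" where
  "pieces K S = {Arc p (next_in S p) | p. p \<in> S} \<union>
     {Circle i | i. i < ncomp K \<and> (\<forall>p\<in>S. fst p \<noteq> i)}"

definition piece_to :: "point set \<Rightarrow> point \<Rightarrow> piece" where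
  "piece_to S p = Arc (prev_in S p) p"

definition piece_from :: "point set \<Rightarrow> point \<Rightarrow> piece" where
  "piece_from S p = Arc p (next_in S p)"

text \<open>The piece containing a passage \<open>q\<close> that is not in \<open>S\<close>.\<close>

definition piece_through :: "point set \<Rightarrow> point \<Rightarrow> piece" where
  "piece_through S q =
     (if \<exists>p\<in>S. fst p = fst q then Arc (prev_in S q) (next_in S q) else Circle (fst q))"


section \<open>The part arc-graph and its flows\<close>

definition part_arcs :: "diagram \<Rightarrow> piece set" where
  "part_arcs K = pieces K (passages K)"

definition part_graph :: "diagram \<Rightarrow> (complex, piece) pre_digraph" where
  "part_graph K =
     \<lparr>verts = crossings K, arcs = part_arcs K - range Circle,
      tail = (\<lambda>a. pt K (start a)), head = (\<lambda>a. pt K (stop a))\<rparr>"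

abbreviation color_in :: "diagram \<Rightarrow> (piece \<Rightarrow> int) \<Rightarrow> point \<Rightarrow> int" where
  "color_in K g p \<equiv> g (piece_to (passages K) p)"

abbreviation color_out :: "diagram \<Rightarrow> (piece \<Rightarrow> int) \<Rightarrow> point \<Rightarrow> int" where
  "color_out K g p \<equiv> g (piece_from (passages K) p)"

text \<open>Closed part arcs are not edges of the digraph, but they are colored as well.\<close>

definition part_flows :: "diagram \<Rightarrow> (piece \<Rightarrow> int) set" where
  "part_flows K = {g \<in> extensional (part_arcs K).
     \<forall>v\<in>verts (part_graph K).
       (\<Sum>a\<in>in_arcs (part_graph K) v. g a) = (\<Sum>a\<in>out_arcs (part_graph K) v. g a)}"

datatype sign = Pos | Neg

definition bounded_part_flows :: "diagram \<Rightarrow> sign \<Rightarrow> int \<Rightarrow> (piece \<Rightarrow> int) set" where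
  "bounded_part_flows K s n = {g \<in> part_flows K.
     (\<forall>a\<in>part_arcs K. g a \<in> {0..n}) \<and>
     (\<forall>p\<in>over K.
        case s of Pos \<Rightarrow> color_in K g p \<le> color_out K g p
                | Neg \<Rightarrow> color_out K g p \<le> color_in K g p)}"


section \<open>The arc-graphs and their flows\<close>

text \<open>The positive arc-graph is obtained by cutting at the underpassages, so that its arcs
  run through the overpassages. For the negative one these roles are exchanged.\<close>

fun cuts :: "diagram \<Rightarrow> sign \<Rightarrow> point set" where
  "cuts K Pos = under K"
| "cuts K Neg = over K"

fun transits :: "diagram \<Rightarrow> sign \<Rightarrow> point set" where
  "transits K Pos = over K"
| "transits K Neg = under K"

definition cut_at :: "diagram \<Rightarrow> sign \<Rightarrow> complex \<Rightarrow> point" where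
  "cut_at K s v = (THE p. p \<in> cuts K s \<and> pt K p = v)"

definition transit_at :: "diagram \<Rightarrow> sign \<Rightarrow> complex \<Rightarrow> point" where
  "transit_at K s v = (THE p. p \<in> transits K s \<and> pt K p = v)"

text \<open>The edges are \<open>Blue v\<close> and \<open>Red v\<close> for the crossings \<open>v\<close>, both leaving the arc that
  ends at \<open>v\<close>. \<open>Chosen a\<close> stands for the chosen part arc \<open>a\<close> of a circle; it is not an
  edge, but flows take a value on it.\<close>

datatype cell = Blue complex | Red complex | Chosen piece

fun cell_tail :: "diagram \<Rightarrow> sign \<Rightarrow> cell \<Rightarrow> piece" where
  "cell_tail K s (Blue v) = piece_to (cuts K s) (cut_at K s v)"
| "cell_tail K s (Red v) = piece_to (cuts K s) (cut_at K s v)"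
| "cell_tail K s (Chosen a) = undefined"

fun cell_head :: "diagram \<Rightarrow> sign \<Rightarrow> cell \<Rightarrow> piece" where
  "cell_head K s (Blue v) = piece_from (cuts K s) (cut_at K s v)"
| "cell_head K s (Red v) = piece_through (cuts K s) (transit_at K s v)"
| "cell_head K s (Chosen a) = undefined"

definition arc_graph :: "diagram \<Rightarrow> sign \<Rightarrow> (piece, cell) pre_digraph" where
  "arc_graph K s =
     \<lparr>verts = pieces K (cuts K s), arcs = Blue ` crossings K \<union> Red ` crossings K,
      tail = cell_tail K s, head = cell_head K s\<rparr>"

definition circles :: "diagram \<Rightarrow> sign \<Rightarrow> nat set" where
  "circles K s = {i. Circle i \<in> verts (arc_graph K s)}"

text \<open>\<open>c i\<close> is the chosen part arc of the over- or undercrossing circle \<open>i\<close>.\<close>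

definition choice_of_part_arcs :: "diagram \<Rightarrow> sign \<Rightarrow> (nat \<Rightarrow> piece) \<Rightarrow> bool" where
  "choice_of_part_arcs K s c \<longleftrightarrow>
     (\<forall>i\<in>circles K s. c i \<in> part_arcs K \<and> component (c i) = i)"

definition flow_domain :: "diagram \<Rightarrow> sign \<Rightarrow> (nat \<Rightarrow> piece) \<Rightarrow> cell set" where
  "flow_domain K s c = arcs (arc_graph K s) \<union> (\<lambda>i. Chosen (c i)) ` circles K s"

text \<open>In the first condition \<open>v\<close> ranges over the arcs among the vertices, each of them
  identified with the crossing at which it ends.\<close>

definition arc_flows :: "diagram \<Rightarrow> sign \<Rightarrow> (nat \<Rightarrow> piece) \<Rightarrow> (cell \<Rightarrow> int) set" where
  "arc_flows K s c = {f \<in> extensional (flow_domain K s c).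
     (\<forall>v\<in>crossings K.
        (\<Sum>e\<in>in_arcs (arc_graph K s) (piece_to (cuts K s) (cut_at K s v)). f e)
          = f (Blue v) + f (Red v)) \<and>
     (\<forall>i\<in>circles K s. (\<Sum>e\<in>in_arcs (arc_graph K s) (Circle i). f e) = 0) \<and>
     (\<forall>i<ncomp K.
        (\<Sum>e | e \<in> Red ` crossings K \<and> component (head (arc_graph K s) e) = i. f e)
          - (\<Sum>e | e \<in> Red ` crossings K \<and> component (tail (arc_graph K s) e) = i. f e) = 0)}"

definition bounded_arc_flows ::
  "diagram \<Rightarrow> sign \<Rightarrow> (nat \<Rightarrow> piece) \<Rightarrow> int \<Rightarrow> (cell \<Rightarrow> int) set" where
  "bounded_arc_flows K s c n = {f \<in> arc_flows K s c.
     (\<forall>e\<in>flow_domain K s c. f e \<in> {0..n}) \<and>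
     (\<forall>v\<in>crossings K. f (Blue v) + f (Red v) \<le> n)}"

text \<open>The relation between a flow \<open>f\<close> on an arc-graph and a coloring \<open>g\<close> of the part arcs:
  blue edges carry the color leaving the crossing on the strand that is cut, red edges the
  amount by which the color of this strand decreases and that of the other strand
  increases.\<close>

definition corresponds ::
  "diagram \<Rightarrow> sign \<Rightarrow> (nat \<Rightarrow> piece) \<Rightarrow> (cell \<Rightarrow> int) \<Rightarrow> (piece \<Rightarrow> int) \<Rightarrow> bool" where
  "corresponds K s c f g \<longleftrightarrow>
     (\<forall>v\<in>crossings K.
        color_out K g (cut_at K s v) = f (Blue v) \<and>
        color_out K g (cut_at K s v) = color_in K g (cut_at K s v) - f (Red v) \<and>
        color_out K g (transit_at K s v) = color_in K g (transit_at K s v) + f (Red v)) \<and>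
     (\<forall>i\<in>circles K s. g (c i) = f (Chosen (c i)))"

end

theory Submission
  imports Defs
begin

text \<open>
  A flow on the arc-graph prescribes, through its red edges, by how much the color of the part
  arcs jumps at every passage. The condition on link components says that the jumps along each
  component add up to zero, so that a coloring with these jumps exists; it is unique up to a
  constant on each component. The constant is fixed by one blue edge, or by the chosen part arc of
  a circle, and the flow conditions at the arcs say that then all blue edges carry the
  right color. This requires finitely many crossings: transverse double points of an immersed
  closed curve are isolated, and the source is compact.
\<close>

section \<open>Finiteness of the set of crossings\<close>

text \<open>Everything is transported to the finite set of passages: a coloring becomes the function
  assigning to a passage the color that leaves it, and the red values become its increments. On each
  component \<open>prev_in\<close> permutes the passages, so a coloring is a discrete antiderivative
  of its jumps. In this language the flow condition at an arc compares two blue values by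
  telescoping between consecutive cuts, and the condition at a circle is the component condition for
  a component without cuts. The orientation enters only through \<open>advance\<close>, where
  returning to the start costs a full turn; this keeps circles with a single mark from being a
  special case. The sign mainly decides which passages are cut, so one argument about
  \<open>cuts\<close> and \<open>transits\<close> serves both signs. The bijection is read off from
  the relation \<open>corresponds\<close>, which is total and single-valued in both directions, and
  the bounds are compared on corresponding pairs.\<close>

lemma smooth_curve_derivatives:
  assumes "smooth_curve \<gamma>"
  shows "(\<gamma> has_vector_derivative vector_derivative \<gamma> (at t)) (at t)"
    and "continuous (at t) (\<lambda>t. vector_derivative \<gamma> (at t))"
proof -
  obtain D where D: "D 0 = \<gamma>" "\<And>k t. (D k has_vector_derivative D (Suc k) t) (at t)"
    using assms unfolding smooth_curve_def by blast
  have "vector_derivative \<gamma> (at t) = D 1 t" for t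
    using D(2)[of 0 t] D(1) by (simp add: vector_derivative_at)
  then show "(\<gamma> has_vector_derivative vector_derivative \<gamma> (at t)) (at t)"
    and "continuous (at t) (\<lambda>t. vector_derivative \<gamma> (at t))"
    using D(2)[of 0] D(2)[of 1] D(1) by (auto intro: has_vector_derivative_continuous)
qed

text \<open>Projected to the direction of the velocity \<open>a\<close> at \<open>t\<close>, the
  curve has derivative |a|^2 > 0 at \<open>t\<close>, hence positive derivative nearby by continuity
  of the velocity, so the projection is strictly increasing there.\<close>

lemma immersed_curve_locally_injective:
  fixes \<gamma> :: "real \<Rightarrow> complex"
  assumes "smooth_curve \<gamma>" and "vector_derivative \<gamma> (at t) \<noteq> 0"
  shows "\<exists>d>0. inj_on \<gamma> (ball t d)"
proof -
  define a where "a = vector_derivative \<gamma> (at t)"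
  note deriv = smooth_curve_derivatives[OF assms(1)]
  have "continuous (at t) (\<lambda>s. Re (cnj a * vector_derivative \<gamma> (at s)))"
    using deriv(2)[of t] by (intro continuous_Re continuous_mult continuous_const)
  moreover have "Re (cnj a * a) > 0"
    using assms(2) unfolding a_def
    by (simp add: complex_eq_iff) (metis not_sum_squares_lt_zero not_less_iff_gr_or_eq sum_squares_gt_zero_iff)
  ultimately have "\<forall>\<^sub>F s in at t. Re (cnj a * vector_derivative \<gamma> (at s)) > 0"
    by (simp add: continuous_at a_def order_tendstoD)
  then obtain d where d: "d > 0"
    "\<And>s. s \<noteq> t \<Longrightarrow> dist s t < d \<Longrightarrow> Re (cnj a * vector_derivative \<gamma> (at s)) > 0"
    unfolding eventually_at by auto
  have pos: "Re (cnj a * vector_derivative \<gamma> (at s)) > 0" if "dist s t < d" for s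
    using d(2)[of s] that \<open>Re (cnj a * a) > 0\<close> by (cases "s = t") (auto simp: a_def)
  have der: "((\<lambda>s. Re (cnj a * \<gamma> s)) has_real_derivative
      Re (cnj a * vector_derivative \<gamma> (at s))) (at s)" for s
    unfolding has_real_derivative_iff_has_vector_derivative
    by (intro bounded_linear.has_vector_derivative[OF bounded_linear_Re]
        bounded_linear.has_vector_derivative[OF bounded_linear_mult_right] deriv(1))
  have "\<gamma> x \<noteq> \<gamma> y" if "x < y" "dist x t < d" "dist y t < d" for x y
  proof -
    have "Re (cnj a * \<gamma> x) < Re (cnj a * \<gamma> y)"
    proof (rule DERIV_pos_imp_increasing[OF that(1)])
      fix s assume "x \<le> s" "s \<le> y"
      then have "dist s t < d"
        using that by (auto simp: dist_real_def)
      then show "\<exists>z. ((\<lambda>s. Re (cnj a * \<gamma> s)) has_real_derivative z) (at s) \<and> 0 < z"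
        using der pos by blast
    qed
    then show ?thesis by auto
  qed
  then have "inj_on \<gamma> (ball t d)"
    unfolding inj_on_def by (metis dist_commute linorder_neqE_linordered_idom mem_ball)
  then show ?thesis
    using d(1) by blast
qed

text \<open>An injective linear map on a finite-dimensional space stretches by at least some
  \<open>B > 0\<close>. Near \<open>x\<close> the error of the linear approximation is at most
  \<open>B / 2\<close> times the distance, which is too small to cancel the linear part.\<close>

lemma has_derivative_inj_isolated:
  fixes f :: "'a::euclidean_space \<Rightarrow> 'b::euclidean_space"
  assumes "(f has_derivative f') (at x)" and "inj f'"
  shows "\<forall>\<^sub>F y in at x. f y \<noteq> f x"
proof -
  have "linear f'"
    using assms(1) has_derivative_linear by blast
  then obtain B where B: "B > 0" "\<And>y. B * norm y \<le> norm (f' y)"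
    using assms(2) linear_inj_bounded_below_pos by blast
  obtain d where d: "d > 0"
    "\<And>y. norm (y - x) < d \<Longrightarrow> norm (f y - f x - f' (y - x)) \<le> B / 2 * norm (y - x)"
    using assms(1) B(1) unfolding has_derivative_at_alt by (meson half_gt_zero)
  have "f y \<noteq> f x" if "y \<noteq> x" "dist y x < d" for y
  proof
    assume "f y = f x"
    then have "norm (f' (y - x)) \<le> B / 2 * norm (y - x)"
      using d(2)[of y] that by (simp add: dist_norm)
    also have "\<dots> < B * norm (y - x)"
      using that B(1) by simp
    finally show False
      using B(2)[of "y - x"] by simp
  qed
  then show ?thesis
    using d(1) unfolding eventually_at by blast
qed

text \<open>Intersections are zeros of the difference map on pairs of parameters; transversality
  says that its derivative at \<open>(t, u)\<close> is injective.\<close>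

lemma transverse_intersection_isolated:
  fixes \<gamma> \<eta> :: "real \<Rightarrow> complex"
  assumes "(\<gamma> has_vector_derivative a) (at t)" and "(\<eta> has_vector_derivative b) (at u)"
    and "Im (cnj a * b) \<noteq> 0" and "\<gamma> t = \<eta> u"
  shows "\<forall>\<^sub>F z in at (t, u). \<gamma> (fst z) \<noteq> \<eta> (snd z)"
proof -
  have "((\<lambda>z. \<gamma> (fst z) - \<eta> (snd z)) has_derivative
      (\<lambda>z. fst z *\<^sub>R a - snd z *\<^sub>R b)) (at (t, u))"
  proof -
    have "((\<lambda>z. \<gamma> (fst z)) has_derivative (\<lambda>z. fst z *\<^sub>R a)) (at (t, u))"
      using has_derivative_compose[of fst fst "(t, u)" UNIV \<gamma> "\<lambda>t. t *\<^sub>R a"] assms(1)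
      by (simp add: has_vector_derivative_def has_derivative_fst has_derivative_ident)
    moreover have "((\<lambda>z. \<eta> (snd z)) has_derivative (\<lambda>z. snd z *\<^sub>R b)) (at (t, u))"
      using has_derivative_compose[of snd snd "(t, u)" UNIV \<eta> "\<lambda>u. u *\<^sub>R b"] assms(2)
      by (simp add: has_vector_derivative_def has_derivative_snd has_derivative_ident)
    ultimately show ?thesis by (rule has_derivative_diff)
  qed
  moreover have "inj (\<lambda>z::real \<times> real. fst z *\<^sub>R a - snd z *\<^sub>R b)"
  proof -
    have "linear (\<lambda>z::real \<times> real. fst z *\<^sub>R a - snd z *\<^sub>R b)"
      by (rule linearI) (auto simp: algebra_simps)
    moreover have "x = 0 \<and> y = 0" if "x *\<^sub>R a - y *\<^sub>R b = 0" for x y :: real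
    proof -
      have "x *\<^sub>R a = y *\<^sub>R b"
        using that by simp
      \<comment> \<open>Pair \<open>x a = y b\<close> with \<open>b\<close> and with
        \<open>a\<close> under the determinant \<open>Im (cnj _ * _)\<close>, which vanishes on
        equal arguments.\<close>
      then have "x * Im (cnj a * b) = 0" "y * Im (cnj a * b) = 0"
        by (auto simp: complex_eq_iff) algebra+
      then show ?thesis using assms(3) by simp
    qed
    ultimately show ?thesis
      unfolding linear_injective_0[OF \<open>linear _\<close>] by (auto simp: prod_eq_iff)
  qed
  ultimately show ?thesis
    using has_derivative_inj_isolated assms(4) by fastforce
qed

lemma Morse_projection_velocity:
  assumes "Morse_projection K" and "i < ncomp K"
  shows "(curve K i has_vector_derivative velocity K i t) (at t)" and "velocity K i t \<noteq> 0"
  using assms smooth_curve_derivatives(1)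
  unfolding Morse_projection_def immersed_def velocity_def by blast+

lemma curve_periodic:
  assumes "Morse_projection K" and "i < ncomp K" and "k \<in> \<int>"
  shows "curve K i (t + k) = curve K i t"
proof -
  have per: "curve K i (t + 1) = curve K i t" for t
    using assms unfolding Morse_projection_def immersed_def by blast
  have nat: "curve K i (t + real n) = curve K i t" for n t
    by (induction n) (use per[of "t + real _"] in \<open>auto simp: algebra_simps\<close>)
  obtain z where "k = of_int z"
    using assms(3) by (auto elim: Ints_cases)
  then show ?thesis
    using nat[of t "nat z"] nat[of "t + k" "nat (- z)"] by (cases "z \<ge> 0") auto
qed

lemma velocity_periodic:
  assumes "Morse_projection K" and "i < ncomp K" and "k \<in> \<int>"
  shows "velocity K i (t + k) = velocity K i t"
proof -
  have "(curve K i \<circ> (\<lambda>s. s + k) has_vector_derivative (1 *\<^sub>R velocity K i (t + k))) (at t)"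
    by (rule vector_diff_chain_at)
      (auto intro!: derivative_eq_intros Morse_projection_velocity assms)
  moreover have "curve K i \<circ> (\<lambda>s. s + k) = curve K i"
    using curve_periodic[OF assms] by auto
  ultimately have "(curve K i has_vector_derivative velocity K i (t + k)) (at t)"
    by simp
  then show ?thesis
    by (metis velocity_def vector_derivative_at)
qed

text \<open>Three cases: equal source points modulo the period (local injectivity), different source
  points with the same image (transversality), different images (continuity). Allowing all real
  parameters, with the trivial coincidences described by integer differences, prepares for a closed
  and hence compact parameter square.\<close>

lemma double_points_isolated:
  assumes K: "Morse_projection K" and i: "i < ncomp K" and j: "j < ncomp K"
  shows "\<forall>\<^sub>F z in at (t, u). curve K i (fst z) = curve K j (snd z) \<longrightarrow>
    i = j \<and> fst z - snd z \<in> \<int>"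
proof (cases "i = j \<and> t - u \<in> \<int>")
  case True
  have "smooth_curve (curve K i)"
    using K i unfolding Morse_projection_def immersed_def by blast
  then obtain d where d: "d > 0" "inj_on (curve K i) (ball t d)"
    using immersed_curve_locally_injective Morse_projection_velocity(2)[OF K i]
    unfolding velocity_def by blast
  \<comment> \<open>The integer shift \<open>t - u\<close> moves the second parameter into the ball
    around \<open>t\<close> without changing its image.\<close>
  have "fst z = snd z + (t - u)"
    if "curve K i (fst z) = curve K j (snd z)" "dist z (t, u) < d" for z
  proof -
    have "dist (fst z) t < d" "dist (snd z) u < d"
      using dist_fst_le[of z "(t, u)"] dist_snd_le[of z "(t, u)"] that(2) by auto
    then have "fst z \<in> ball t d" "snd z + (t - u) \<in> ball t d"
      by (auto simp: dist_real_def)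
    moreover have "curve K i (snd z + (t - u)) = curve K i (fst z)"
      using curve_periodic[OF K i] True that(1) by simp
    ultimately show ?thesis
      using d(2) unfolding inj_on_def by metis
  qed
  then show ?thesis
    unfolding eventually_at using d(1) True by (metis add_diff_cancel_left')
next
  case False
  show ?thesis
  proof (cases "curve K i t = curve K j u")
    case True
    \<comment> \<open>Genericity is stated only for parameters in [0,1), so \<open>t\<close> and
      \<open>u\<close> are reduced modulo 1.\<close>
    have frac: "curve K l (frac x) = curve K l x" "velocity K l (frac x) = velocity K l x"
      if "l < ncomp K" for l x
      using curve_periodic[OF K that, of "- of_int \<lfloor>x\<rfloor>" x]
        velocity_periodic[OF K that, of "- of_int \<lfloor>x\<rfloor>" x] by (simp_all add: frac_def)
    have src: "(i, frac t) \<in> source K" "(j, frac u) \<in> source K"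
      using i j by (auto simp: source_def frac_lt_1)
    have "(i, frac t) \<noteq> (j, frac u)"
    proof
      assume *: "(i, frac t) = (j, frac u)"
      then have "t - u = of_int (\<lfloor>t\<rfloor> - \<lfloor>u\<rfloor>)"
        by (simp add: frac_def)
      then show False
        using * False by (metis Ints_of_int Pair_inject)
    qed
    moreover have "pt K (i, frac t) = pt K (j, frac u)"
      using True frac i j by (simp add: pt_def)
    moreover have "\<forall>p\<in>source K. \<forall>q\<in>source K. p \<noteq> q \<and> pt K p = pt K q \<longrightarrow>
        Im (cnj (velocity K (fst p) (snd p)) * velocity K (fst q) (snd q)) \<noteq> 0"
      using K unfolding Morse_projection_def generic_def by blast
    ultimately have "Im (cnj (velocity K i (frac t)) * velocity K j (frac u)) \<noteq> 0"
      using src by (metis fst_conv snd_conv)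
    then have "Im (cnj (velocity K i t) * velocity K j u) \<noteq> 0"
      using frac(2) i j by simp
    then have "\<forall>\<^sub>F z in at (t, u). curve K i (fst z) \<noteq> curve K j (snd z)"
      using transverse_intersection_isolated Morse_projection_velocity(1)[OF K] i j True by blast
    then show ?thesis
      by (rule eventually_mono) simp
  next
    case False
    have cont: "isCont (curve K l) x" if "l < ncomp K" for l x
      using Morse_projection_velocity(1)[OF K that] has_vector_derivative_continuous by blast
    have "isCont (\<lambda>z. curve K i (fst z) - curve K j (snd z)) (t, u)"
      using isCont_o2[of "(t, u)" fst "curve K i"] isCont_o2[of "(t, u)" snd "curve K j"] cont i j
      by (simp add: isCont_fst isCont_snd)
    then have "\<forall>\<^sub>F z in at (t, u). curve K i (fst z) - curve K j (snd z) \<noteq> 0"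
      using False by (intro tendsto_imp_eventually_ne) (auto simp: isCont_def)
    then show ?thesis
      by (rule eventually_mono) simp
  qed
qed

text \<open>Infinitely many pairs of double point parameters would accumulate in the compact unit
  square, against their isolation at the limit point.\<close>

lemma finite_passages:
  assumes K: "Morse_projection K"
  shows "finite (passages K)"
proof -
  \<comment> \<open>Excluding integer differences removes the diagonal as well as the pairs (0, 1)
    and (1, 0), which the closed square adds for \<open>i = j\<close>.\<close>
  define D where "D i j = {z \<in> {0..1} \<times> {0..1}. curve K i (fst z) = curve K j (snd z) \<and>
    \<not> (i = j \<and> fst z - snd z \<in> \<int>)}" for i j
  have "finite (D i j)" if "i < ncomp K" "j < ncomp K" for i j
  proof (rule ccontr)
    assume "infinite (D i j)"
    moreover have "compact ({0..1::real} \<times> {0..1::real})"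
      by (intro compact_Times) auto
    moreover have "D i j \<subseteq> {0..1} \<times> {0..1}"
      unfolding D_def by blast
    ultimately obtain x where "x islimpt D i j"
      using Heine_Borel_imp_Bolzano_Weierstrass by blast
    then have "\<exists>\<^sub>F z in at x. z \<in> D i j"
      by (simp add: islimpt_conv_frequently_at)
    moreover have "\<forall>\<^sub>F z in at x. z \<notin> D i j"
      using double_points_isolated[OF K that, of "fst x" "snd x"]
      unfolding D_def by (auto elim: eventually_mono)
    ultimately show False
      by (simp add: frequently_def)
  qed
  moreover have "passages K \<subseteq> (\<Union>i<ncomp K. \<Union>j<ncomp K. Pair i ` fst ` D i j)"
  proof
    fix p assume "p \<in> passages K"
    then obtain q where q: "p \<in> source K" "q \<in> source K" "q \<noteq> p" "pt K q = pt K p"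
      unfolding passages_def by blast
    obtain i t j u where pq: "p = (i, t)" "q = (j, u)"
      by (cases p, cases q)
    then have range: "i < ncomp K" "j < ncomp K" "0 \<le> t" "t < 1" "0 \<le> u" "u < 1"
      using q(1,2) by (auto simp: source_def)
    have "\<not> (i = j \<and> t - u \<in> \<int>)"
    proof
      assume *: "i = j \<and> t - u \<in> \<int>"
      moreover have "\<bar>t - u\<bar> < 1"
        using range by auto
      ultimately have "t = u"
        using Ints_nonzero_abs_less1 by fastforce
      then show False
        using * q(3) pq by simp
    qed
    then have "(t, u) \<in> D i j"
      using q(4) pq range by (simp add: D_def pt_def)
    then show "p \<in> (\<Union>i<ncomp K. \<Union>j<ncomp K. Pair i ` fst ` D i j)"
      using range pq by force
  qed
  ultimately show ?thesis
    by (meson finite_UN_I finite_imageI finite_lessThan finite_subset lessThan_iff)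
qed

section \<open>Cyclic order of marked points\<close>

lemma advance_inj:
  assumes "t \<in> {0..<1}" "u \<in> {0..<1}" "w \<in> {0..<1}"
  shows "advance t u = advance t w \<longleftrightarrow> u = w" "advance u t = advance w t \<longleftrightarrow> u = w"
  using assms by (auto simp: advance_def split: if_splits)

text \<open>The condition says that \<open>w\<close> lies on the way from \<open>u\<close> to \<open>t\<close>.\<close>

lemma advance_split_end:
  assumes "t \<in> {0..<1}" "u \<in> {0..<1}" "w \<in> {0..<1}" and "advance w t < advance u t"
  shows "advance u t = advance u w + advance w t"
  using assms by (auto simp: advance_def split: if_splits)

text \<open>Here \<open>w\<close> is at least as close behind \<open>t\<close> as \<open>u\<close>
  is, so the way from \<open>w\<close> to \<open>u\<close> meets \<open>t\<close> first. For
  \<open>u = w\<close> both sides are a full turn.\<close>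

lemma advance_split_start:
  assumes "t \<in> {0..<1}" "u \<in> {0..<1}" "w \<in> {0..<1}" and "u \<noteq> t" "w \<noteq> t"
    and "advance w t \<le> advance u t"
  shows "advance w u = advance w t + advance t u"
  using assms by (cases "w < t"; cases "w < u"; cases "u < t") (simp_all add: advance_def)

text \<open>If \<open>u\<close> differed from \<open>t\<close>, the first inequality would put it on
  the way from \<open>t\<close> to \<open>w\<close>, so that it would be reached before
  \<open>w\<close>. The case \<open>u = t\<close> escapes because \<open>advance t t\<close> is a
  full turn.\<close>

lemma advance_betweenD:
  assumes "t \<in> {0..<1}" "u \<in> {0..<1}" "w \<in> {0..<1}"
    and "advance u w \<le> advance t w" "advance t w \<le> advance t u"
  shows "u = t"
  using assms by (auto simp: advance_def split: if_splits)

text \<open>The mirror image of \<open>advance_betweenD\<close> under reversal of the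
  orientation.\<close>

lemma advance_betweenD':
  assumes "t \<in> {0..<1}" "u \<in> {0..<1}" "w \<in> {0..<1}"
    and "advance w u \<le> advance w t" "advance w t \<le> advance u t"
  shows "u = t"
  using assms by (auto simp: advance_def split: if_splits)

locale marks =
  fixes S :: "point set"
  assumes finite_marks: "finite S"
    and marks_range: "p \<in> S \<Longrightarrow> snd p \<in> {0..<1}"
begin

text \<open>Finiteness is what makes the \<open>ARG_MIN\<close> in \<open>prev_in\<close> attained;
  \<open>r\<close> only witnesses that the circle of \<open>p\<close> carries a mark. The point
  \<open>p\<close> may lie outside \<open>S\<close>, so that passages can be located relative to the
  cuts.\<close>

lemma prev_in_minimal:
  assumes "r \<in> S" "fst r = fst p" "snd p \<in> {0..<1}"
  shows "prev_in S p \<in> S" and "fst (prev_in S p) = fst p"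
    and "\<And>q. q \<in> S \<Longrightarrow> fst q = fst p \<Longrightarrow>
      advance (snd (prev_in S p)) (snd p) \<le> advance (snd q) (snd p)"
proof -
  define A where "A = {u. (fst p, u) \<in> S}"
  have "A = snd ` {q \<in> S. fst q = fst p}"
    unfolding A_def by force
  moreover have "snd r \<in> A"
    unfolding A_def using assms(1,2) by (metis mem_Collect_eq prod.collapse)
  ultimately have A: "finite A" "A \<noteq> {}"
    using finite_marks by auto
  have def: "prev_in S p = (fst p, arg_min_on (\<lambda>u. advance u (snd p)) A)"
    by (simp add: prev_in_def arg_min_on_def A_def)
  show "prev_in S p \<in> S" "fst (prev_in S p) = fst p"
    using arg_min_if_finite(1)[OF A] unfolding def by (auto simp: A_def)
  show "advance (snd (prev_in S p)) (snd p) \<le> advance (snd q) (snd p)"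
    if "q \<in> S" "fst q = fst p" for q
    using arg_min_if_finite(2)[OF A, of "\<lambda>u. advance u (snd p)"] that
    unfolding def A_def by (metis (no_types, lifting) linorder_not_le mem_Collect_eq prod.collapse snd_conv)
qed

lemma next_in_minimal:
  assumes "r \<in> S" "fst r = fst p" "snd p \<in> {0..<1}"
  shows "next_in S p \<in> S" and "fst (next_in S p) = fst p"
    and "\<And>q. q \<in> S \<Longrightarrow> fst q = fst p \<Longrightarrow>
      advance (snd p) (snd (next_in S p)) \<le> advance (snd p) (snd q)"
proof -
  define A where "A = {u. (fst p, u) \<in> S}"
  have "A = snd ` {q \<in> S. fst q = fst p}"
    unfolding A_def by force
  moreover have "snd r \<in> A"
    unfolding A_def using assms(1,2) by (metis mem_Collect_eq prod.collapse)
  ultimately have A: "finite A" "A \<noteq> {}"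
    using finite_marks by auto
  have def: "next_in S p = (fst p, arg_min_on (\<lambda>u. advance (snd p) u) A)"
    by (simp add: next_in_def arg_min_on_def A_def)
  show "next_in S p \<in> S" "fst (next_in S p) = fst p"
    using arg_min_if_finite(1)[OF A] unfolding def by (auto simp: A_def)
  show "advance (snd p) (snd (next_in S p)) \<le> advance (snd p) (snd q)"
    if "q \<in> S" "fst q = fst p" for q
    using arg_min_if_finite(2)[OF A, of "\<lambda>u. advance (snd p) u"] that
    unfolding def A_def by (metis (no_types, lifting) linorder_not_le mem_Collect_eq prod.collapse snd_conv)
qed

lemma prev_in_eqI:
  assumes "q \<in> S" "fst q = fst p" "snd p \<in> {0..<1}"
    and "\<And>r. r \<in> S \<Longrightarrow> fst r = fst p \<Longrightarrow> advance (snd q) (snd p) \<le> advance (snd r) (snd p)"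
  shows "prev_in S p = q"
proof (rule prod_eqI)
  note * = prev_in_minimal[OF assms(1-3)]
  show "fst (prev_in S p) = fst q"
    using * assms by simp
  show "snd (prev_in S p) = snd q"
    using *(3)[OF assms(1,2)] assms(4)[OF *(1,2)] advance_inj(2) marks_range[OF *(1)]
      marks_range[OF assms(1)] assms(3) by (meson order_antisym)
qed

lemma next_in_eqI:
  assumes "q \<in> S" "fst q = fst p" "snd p \<in> {0..<1}"
    and "\<And>r. r \<in> S \<Longrightarrow> fst r = fst p \<Longrightarrow> advance (snd p) (snd q) \<le> advance (snd p) (snd r)"
  shows "next_in S p = q"
proof (rule prod_eqI)
  note * = next_in_minimal[OF assms(1-3)]
  show "fst (next_in S p) = fst q"
    using * assms by simp
  show "snd (next_in S p) = snd q"
    using *(3)[OF assms(1,2)] assms(4)[OF *(1,2)] advance_inj(1) marks_range[OF *(1)]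
      marks_range[OF assms(1)] assms(3) by (meson order_antisym)
qed

lemma prev_in_mem [simp]:
  assumes "p \<in> S"
  shows "prev_in S p \<in> S" "fst (prev_in S p) = fst p"
  using prev_in_minimal[OF assms refl marks_range[OF assms]] by auto

lemma next_in_mem [simp]:
  assumes "p \<in> S"
  shows "next_in S p \<in> S" "fst (next_in S p) = fst p"
  using next_in_minimal[OF assms refl marks_range[OF assms]] by auto

lemma prev_next [simp]:
  assumes "p \<in> S"
  shows "prev_in S (next_in S p) = p"
proof (rule prod_eqI)
  note n = next_in_minimal[OF assms refl marks_range[OF assms]]
  note m = prev_in_minimal[OF n(1) refl marks_range[OF n(1)]]
  show "fst (prev_in S (next_in S p)) = fst p"
    using m n by simp
  show "snd (prev_in S (next_in S p)) = snd p"
    by (rule advance_betweenD[where w = "snd (next_in S p)"]) (use m n assms marks_range in auto)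
qed

lemma next_prev [simp]:
  assumes "p \<in> S"
  shows "next_in S (prev_in S p) = p"
proof (rule prod_eqI)
  note n = prev_in_minimal[OF assms refl marks_range[OF assms]]
  note m = next_in_minimal[OF n(1) refl marks_range[OF n(1)]]
  show "fst (next_in S (prev_in S p)) = fst p"
    using m n by simp
  show "snd (next_in S (prev_in S p)) = snd p"
    by (rule advance_betweenD'[where w = "snd (prev_in S p)"]) (use m n assms marks_range in auto)
qed

text \<open>Induction backwards around a circle: stepping to the predecessor visits every mark on
  it.\<close>

lemma prev_in_cyclic:
  assumes "p \<in> S" "Q p" and step: "\<And>p. p \<in> S \<Longrightarrow> Q p \<Longrightarrow> Q (prev_in S p)"
    and "q \<in> S" "fst q = fst p"
  shows "Q q"
proof (rule ccontr)
  assume "\<not> Q q"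
  let ?A = "{r \<in> S. fst r = fst q \<and> Q r}"
  have "finite ?A" "p \<in> ?A"
    by (simp add: finite_marks) (simp add: assms(1,2,5))
  then have "?A \<noteq> {}"
    by blast
  \<comment> \<open>The first mark after \<open>q\<close> that satisfies \<open>Q\<close>. Its
    predecessor satisfies \<open>Q\<close> too and cannot come earlier, so it can only be
    \<open>q\<close> itself.\<close>
  define r where "r = arg_min_on (\<lambda>x. advance (snd q) (snd x)) ?A"
  have "r \<in> ?A"
    unfolding r_def by (rule arg_min_if_finite(1)[OF \<open>finite ?A\<close> \<open>?A \<noteq> {}\<close>])
  then have r: "r \<in> S" "fst r = fst q" "Q r"
    by simp_all
  let ?r = "prev_in S r"
  have rA: "?r \<in> S" "fst ?r = fst q" "Q ?r"
    by (rule prev_in_mem(1)[OF r(1)], simp add: r, rule step[OF r(1,3)])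
  then have "?r \<in> ?A"
    by simp
  have "advance (snd ?r) (snd r) \<le> advance (snd q) (snd r)"
    by (rule prev_in_minimal(3)[OF r(1) refl marks_range[OF r(1)] assms(4) r(2)[symmetric]])
  moreover have "\<not> advance (snd q) (snd ?r) < advance (snd q) (snd r)"
    using arg_min_if_finite(2)[OF \<open>finite ?A\<close> \<open>?A \<noteq> {}\<close>,
        of "\<lambda>x. advance (snd q) (snd x)", folded r_def] \<open>?r \<in> ?A\<close> by blast
  then have "advance (snd q) (snd r) \<le> advance (snd q) (snd ?r)"
    by (simp only: not_less)
  ultimately have "snd ?r = snd q"
    by (rule advance_betweenD[OF marks_range[OF assms(4)] marks_range[OF rA(1)] marks_range[OF r(1)]])
  with rA(2) have "?r = q"
    by (rule prod_eqI)
  with rA(3) \<open>\<not> Q q\<close> show False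
    by (simp only:)
qed

text \<open>By contraposition: if \<open>Q\<close> is inherited by successors, its failure is
  inherited by predecessors.\<close>

lemma next_in_cyclic:
  assumes "p \<in> S" "Q p" and step: "\<And>p. p \<in> S \<Longrightarrow> Q p \<Longrightarrow> Q (next_in S p)"
    and "q \<in> S" "fst q = fst p"
  shows "Q q"
proof (rule ccontr)
  assume "\<not> Q q"
  moreover have "\<not> Q (prev_in S r)" if "r \<in> S" "\<not> Q r" for r
    using step[of "prev_in S r"] that by auto
  ultimately show False
    using prev_in_cyclic[of q "\<lambda>r. \<not> Q r" p] assms(1,2,4,5) by metis
qed

lemma prev_in_bij: "bij_betw (prev_in S) {p \<in> S. fst p = i} {p \<in> S. fst p = i}"
  by (rule bij_betwI[where g = "next_in S"]) auto

text \<open>\<open>prev_in\<close> permutes the marks of a circle, so the two sums agree.\<close>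

lemma sum_circle:
  fixes h :: "point \<Rightarrow> 'a::ab_group_add"
  shows "(\<Sum>p | p \<in> S \<and> fst p = i. h p - h (prev_in S p)) = 0"
  using sum.reindex_bij_betw[OF prev_in_bij, of h i] by (simp add: sum_subtractf)

text \<open>Partial sums of \<open>d\<close> from parameter 0 give the potential; the vanishing
  total makes it consistent across the base point.\<close>

lemma potential_exists:
  fixes d :: "point \<Rightarrow> 'a::ab_group_add"
  assumes "\<And>i. (\<Sum>p | p \<in> S \<and> fst p = i. d p) = 0"
  obtains h where "\<And>p. p \<in> S \<Longrightarrow> h p = h (prev_in S p) + d p"
proof
  define L where "L p = {q \<in> S. fst q = fst p \<and> snd q \<le> snd p}" for p
  define h where "h p = sum d (L p)" for p
  show "h p = h (prev_in S p) + d p" if p: "p \<in> S" for p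
  proof -
    note m = prev_in_minimal[OF p refl marks_range[OF p]]
    have mr: "snd q \<in> {0..<1}" if "q \<in> S" for q
      using marks_range that by blast
    show ?thesis
    proof (cases "snd (prev_in S p) < snd p")
      case True
      have "snd q \<le> snd (prev_in S p)" if "q \<in> S" "fst q = fst p" "snd q < snd p" for q
        using m(3)[of q] True that by (auto simp: advance_def)
      then have "L p = insert p (L (prev_in S p))"
        using True p m(2) by (fastforce simp: L_def prod_eq_iff)
      moreover have "p \<notin> L (prev_in S p)" "finite (L (prev_in S p))"
        using True finite_marks by (auto simp: L_def)
      ultimately show ?thesis
        by (simp add: h_def add.commute)
    next
      \<comment> \<open>The step to \<open>p\<close> crosses parameter 0: \<open>p\<close> is the
        first mark of its circle and its predecessor the last, where the partial sum is the full
        sum, namely 0.\<close>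
      case False
      have lt: "\<not> snd q < snd p" "snd q \<le> snd (prev_in S p)" if "q \<in> S" "fst q = fst p" for q
        using m(3)[of q] False that mr[OF that(1)] mr[OF p] mr[OF m(1)]
        by (auto simp: advance_def split: if_splits)
      then have "L p = {p}"
        using p by (fastforce simp: L_def prod_eq_iff)
      moreover have "L (prev_in S p) = {q \<in> S. fst q = fst p}"
        using lt m(2) by (auto simp: L_def)
      ultimately show ?thesis
        using assms by (simp add: h_def)
    qed
  qed
qed

end

section \<open>Cyclic order for a set of marks and a coarser subset\<close>

locale nested_marks = marks P for P :: "point set" +
  fixes S :: "point set"
  assumes subset: "S \<subseteq> P"

sublocale nested_marks \<subseteq> sub: marks S
  using finite_subset[OF subset finite_marks] subset marks_range by unfold_locales blast+

context nested_marks
begin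

text \<open>No mark of \<open>P\<close>, hence none of \<open>S\<close>, lies strictly between the
  \<open>P\<close>-predecessor and \<open>p\<close>, so the search for the last
  \<open>S\<close>-mark may resume at that predecessor.\<close>

lemma prev_in_step:
  assumes p: "p \<in> P" and "r \<in> S" "fst r = fst p"
  shows "prev_in S p = (if prev_in P p \<in> S then prev_in P p else prev_in S (prev_in P p))"
proof -
  define p' where "p' = prev_in P p"
  note m = prev_in_minimal[OF p refl marks_range[OF p], folded p'_def]
  show ?thesis
  proof (cases "p' \<in> S")
    case True
    then show ?thesis
      using sub.prev_in_eqI[of p' p] m marks_range[OF p] subset by (auto simp: p'_def)
  next
    case False
    note y = sub.prev_in_minimal[of r p', OF assms(2) _ marks_range[OF m(1)]]
    let ?y = "prev_in S p'"
    have y': "?y \<in> S" "fst ?y = fst p"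
      using y m(2) assms(3) by auto
    \<comment> \<open>All distances to \<open>p\<close> exceed those to \<open>p'\<close> by the
      same amount, so the minimizer is the same.\<close>
    have split: "advance (snd q) (snd p) = advance (snd q) (snd p') + advance (snd p') (snd p)"
      if q: "q \<in> S" "fst q = fst p" for q
    proof -
      have "snd q \<noteq> snd p'"
        using q False m(2) by (metis prod_eqI)
      moreover have "snd q \<in> {0..<1}" "snd p' \<in> {0..<1}" "snd p \<in> {0..<1}"
        using q subset m(1) p marks_range by blast+
      ultimately have "advance (snd p') (snd p) \<noteq> advance (snd q) (snd p)"
        using advance_inj(2) by metis
      then have "advance (snd p') (snd p) < advance (snd q) (snd p)"
        using m(3)[of q] q subset by fastforce
      then show ?thesis
        using advance_split_end \<open>snd q \<in> _\<close> \<open>snd p' \<in> _\<close> \<open>snd p \<in> _\<close> by blast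
    qed
    have "prev_in S p = ?y"
    proof (rule sub.prev_in_eqI[OF y' marks_range[OF p]])
      fix q assume "q \<in> S" "fst q = fst p"
      then show "advance (snd ?y) (snd p) \<le> advance (snd q) (snd p)"
        using split y' y(3)[of q] m(2) assms(3) by simp
    qed
    then show ?thesis
      using False by (simp add: p'_def)
  qed
qed

text \<open>The cuts around an uncut passage are consecutive, which makes
  \<open>piece_through\<close> one of the pieces obtained by cutting: measured from the cut before
  \<open>p\<close>, all distances to marks grow by one constant.\<close>

lemma next_in_prev_in:
  assumes p: "p \<in> P" "p \<notin> S" and r: "r \<in> S" "fst r = fst p"
  shows "next_in S (prev_in S p) = next_in S p"
proof -
  have pr: "snd p \<in> {0..<1}"
    using p marks_range by blast
  note y = sub.prev_in_minimal[OF r pr]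
  note w = sub.next_in_minimal[OF r pr]
  let ?y = "prev_in S p" and ?w = "next_in S p"
  have split: "advance (snd ?y) (snd q) = advance (snd ?y) (snd p) + advance (snd p) (snd q)"
    if "q \<in> S" "fst q = fst p" for q
  proof -
    have "snd q \<noteq> snd p"
      using that p(2) prod_eqI[of q p] by blast
    moreover have "snd ?y \<noteq> snd p"
      using y(1,2) p(2) prod_eqI[of ?y p] by fastforce
    ultimately show ?thesis
      by (rule advance_split_start[OF pr sub.marks_range[OF that(1)] sub.marks_range[OF y(1)]])
        (rule y(3)[OF that])
  qed
  show ?thesis
  proof (rule sub.next_in_eqI[OF w(1) _ sub.marks_range[OF y(1)]])
    show "fst ?w = fst ?y"
      using w(2) y(2) by simp
    fix q assume "q \<in> S" "fst q = fst ?y"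
    then have q: "q \<in> S" "fst q = fst p"
      using y(2) by auto
    show "advance (snd ?y) (snd ?w) \<le> advance (snd ?y) (snd q)"
      unfolding split[OF q] split[OF w(1,2)] using w(3)[OF q] by simp
  qed
qed

text \<open>With y the predecessor of \<open>x\<close> in \<open>S\<close>, the summation range is
  the half-open stretch from y (excluded) to \<open>x\<close> (included). \<open>prev_in P\<close>
  carries it bijectively to the stretch with y included and \<open>x\<close> excluded, and the sum
  telescopes.\<close>

lemma sum_between:
  fixes h :: "point \<Rightarrow> 'a::ab_group_add"
  assumes x: "x \<in> S"
  shows "(\<Sum>p | p \<in> P \<and> fst p = fst x \<and> prev_in S p = prev_in S x. h p - h (prev_in P p))
    = h x - h (prev_in S x)"
proof -
  let ?y = "prev_in S x"
  \<comment> \<open>The interior of the stretch. If \<open>x\<close> is the only mark of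
    \<open>S\<close> on its circle, then \<open>?y = x\<close> and inserting either end gives the
    same set.\<close>
  define T where "T = {p \<in> P. fst p = fst x \<and> prev_in S p = ?y \<and> p \<notin> S}"
  have "p = x" if "p \<in> S" "prev_in S p = ?y" for p
    by (rule trans[OF sub.next_prev[OF that(1), symmetric, unfolded that(2)] sub.next_prev[OF x]])
  then have W: "{p \<in> P. fst p = fst x \<and> prev_in S p = ?y} = insert x T"
    using subsetD[OF subset x] unfolding T_def by (intro equalityI subsetI) (simp, blast, auto)
  have T: "x \<notin> T" "?y \<notin> T" "finite T"
    using x finite_marks sub.prev_in_mem by (auto simp: T_def)
  have step: "prev_in S p = (if prev_in P p \<in> S then prev_in P p else prev_in S (prev_in P p))"
    if "p \<in> P" "fst p = fst x" for p
    using prev_in_step[OF that(1) x] that(2) by simp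
  have yP: "?y \<in> P" "fst ?y = fst x"
    using x sub.prev_in_mem subset by auto
  have "bij_betw (prev_in P) (insert x T) (insert ?y T)"
  proof (rule bij_betwI[where g = "next_in P"])
    show "prev_in P \<in> insert x T \<rightarrow> insert ?y T"
    proof
      fix p assume "p \<in> insert x T"
      then have "p \<in> P" "fst p = fst x" "prev_in S p = ?y"
        unfolding W[symmetric] by auto
      then show "prev_in P p \<in> insert ?y T"
        using step[of p] by (auto simp: T_def split: if_splits)
    qed
    show "next_in P \<in> insert ?y T \<rightarrow> insert x T"
    proof
      fix q assume q: "q \<in> insert ?y T"
      then have qP: "q \<in> P" "fst q = fst x"
        using yP by (auto simp: T_def)
      have "prev_in S (next_in P q) = (if q \<in> S then q else prev_in S q)"
        using step[of "next_in P q"] qP by simp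
      also have "\<dots> = ?y"
        using q sub.prev_in_mem(1)[OF x] by (auto simp: T_def)
      finally show "next_in P q \<in> insert x T"
        unfolding W[symmetric] using qP by simp
    qed
    show "next_in P (prev_in P p) = p" if "p \<in> insert x T" for p
      using that x subset by (intro next_prev) (auto simp: T_def)
    show "prev_in P (next_in P q) = q" if "q \<in> insert ?y T" for q
      using that yP(1) by (intro prev_next) (auto simp: T_def)
  qed
  then have "(\<Sum>p\<in>insert x T. h (prev_in P p)) = (\<Sum>p\<in>insert ?y T. h p)"
    by (rule sum.reindex_bij_betw)
  then show ?thesis
    unfolding W sum_subtractf sum.insert[OF T(3,1)] sum.insert[OF T(3,2)] by simp
qed

end

section \<open>Flows on the arc-graphs as color jumps at the passages\<close>

locale cut_diagram =
  fixes K :: diagram and s :: sign and c :: "nat \<Rightarrow> piece"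
  assumes Morse: "Morse_projection K" and choice: "choice_of_part_arcs K s c"
begin

abbreviation "P \<equiv> passages K"
abbreviation "C \<equiv> cuts K s"
abbreviation "T \<equiv> transits K s"
abbreviation "X \<equiv> crossings K"
abbreviation "col_in g p \<equiv> color_in K g p"
abbreviation "col_out g p \<equiv> color_out K g p"

section \<open>Crossings and their two passages\<close>

lemma over_subset: "over K \<subseteq> P"
  using Morse unfolding Morse_projection_def crossing_info_def by blast

lemma cuts_Un_transits: "C \<union> T = P" and cuts_Int_transits: "C \<inter> T = {}"
  using over_subset by (cases s; auto simp: under_def)+

lemma passage_source: "p \<in> P \<Longrightarrow> p \<in> source K"
  by (simp add: passages_def)

sublocale nested_marks P C
proof
  show "finite P"
    by (rule finite_passages[OF Morse])
  show "snd p \<in> {0..<1}" if "p \<in> P" for p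
    using passage_source[OF that] by (auto simp: source_def)
  show "C \<subseteq> P"
    using cuts_Un_transits by blast
qed

lemma transits_subset: "T \<subseteq> P"
  using cuts_Un_transits by blast

lemma fst_less_ncomp: "p \<in> P \<Longrightarrow> fst p < ncomp K"
  using passage_source[of p] by (auto simp: source_def)

lemma ex1_over: "v \<in> X \<Longrightarrow> \<exists>!p. p \<in> over K \<and> pt K p = v"
  using Morse unfolding Morse_projection_def crossing_info_def by blast

text \<open>A crossing has two passages by definition and no third one by genericity; exactly one of
  them is over.\<close>

lemma ex1_under:
  assumes "v \<in> X"
  shows "\<exists>!p. p \<in> under K \<and> pt K p = v"
proof -
  obtain r where r: "r \<in> over K" "pt K r = v"
    and uniq: "\<And>q. q \<in> over K \<Longrightarrow> pt K q = v \<Longrightarrow> q = r"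
    using ex1_over[OF assms] by metis
  obtain p q where pq: "p \<in> source K" "q \<in> source K" "q \<noteq> p" "pt K q = pt K p" "pt K p = v"
    using assms unfolding crossings_def passages_def by blast
  have P: "p \<in> P" "q \<in> P"
    unfolding passages_def using pq by (blast, metis (mono_tags, lifting) mem_Collect_eq)
  have "\<exists>u. u \<in> under K \<and> pt K u = v"
  proof (cases "p \<in> over K")
    case True
    then have "q \<notin> over K"
      using uniq pq(3,4,5) by metis
    then show ?thesis
      using P(2) pq(4,5) unfolding under_def by (metis DiffI)
  next
    case False
    then show ?thesis
      using P(1) pq(5) unfolding under_def by (metis DiffI)
  qed
  moreover have "u = u'" if "u \<in> under K" "pt K u = v" "u' \<in> under K" "pt K u' = v" for u u'
  proof -
    have "\<forall>p\<in>source K. \<forall>q\<in>source K. \<forall>r\<in>source K.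
        pt K p = pt K q \<and> pt K q = pt K r \<longrightarrow> p = q \<or> q = r \<or> p = r"
      using Morse unfolding Morse_projection_def generic_def by blast
    moreover have "u \<in> source K" "u' \<in> source K" "u \<noteq> r" "u' \<noteq> r"
      using that(1,3) r(1) passage_source unfolding under_def by blast+
    moreover have "r \<in> source K"
      using r(1) over_subset passage_source by blast
    ultimately show ?thesis
      using that r(2) by metis
  qed
  ultimately show ?thesis
    by blast
qed

lemma cut_at_crossing:
  assumes "v \<in> X"
  shows "cut_at K s v \<in> C" and "pt K (cut_at K s v) = v"
proof -
  have "\<exists>!p. p \<in> C \<and> pt K p = v"
    using ex1_over[OF assms] ex1_under[OF assms] by (cases s) simp_all
  from theI'[OF this] show "cut_at K s v \<in> C" "pt K (cut_at K s v) = v"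
    unfolding cut_at_def by blast+
qed

lemma transit_at_crossing:
  assumes "v \<in> X"
  shows "transit_at K s v \<in> T" and "pt K (transit_at K s v) = v"
proof -
  have "\<exists>!p. p \<in> T \<and> pt K p = v"
    using ex1_over[OF assms] ex1_under[OF assms] by (cases s) simp_all
  from theI'[OF this] show "transit_at K s v \<in> T" "pt K (transit_at K s v) = v"
    unfolding transit_at_def by blast+
qed

lemma crossing_of_passage: "p \<in> P \<Longrightarrow> pt K p \<in> X"
  by (simp add: crossings_def)

lemma cut_at_pt: "p \<in> C \<Longrightarrow> cut_at K s (pt K p) = p"
proof -
  assume p: "p \<in> C"
  then have "pt K p \<in> X"
    using subset crossing_of_passage by blast
  then have "\<exists>!q. q \<in> C \<and> pt K q = pt K p"
    using ex1_over ex1_under by (cases s) simp_all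
  then show ?thesis
    unfolding cut_at_def by (rule the1_equality) (simp add: p)
qed

lemma transit_at_pt: "p \<in> T \<Longrightarrow> transit_at K s (pt K p) = p"
proof -
  assume p: "p \<in> T"
  then have "pt K p \<in> X"
    using transits_subset crossing_of_passage by blast
  then have "\<exists>!q. q \<in> T \<and> pt K q = pt K p"
    using ex1_over ex1_under by (cases s) simp_all
  then show ?thesis
    unfolding transit_at_def by (rule the1_equality) (simp add: p)
qed

text \<open>\<open>pt K\<close> is a bijection to the crossings from the cuts and from the transits
  alike. This lemma and the next three use it to turn conditions at crossings into conditions at
  passages.\<close>

lemma ball_crossings_cuts: "(\<forall>v\<in>X. Q v) \<longleftrightarrow> (\<forall>p\<in>C. Q (pt K p))"
  using cut_at_crossing crossing_of_passage subset by (metis subsetD)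

lemma ball_crossings_transits: "(\<forall>v\<in>X. Q v) \<longleftrightarrow> (\<forall>p\<in>T. Q (pt K p))"
  using transit_at_crossing crossing_of_passage transits_subset by (metis subsetD)

lemma sum_crossings_cuts:
  "(\<Sum>v | v \<in> X \<and> Q (cut_at K s v). F v) = (\<Sum>p | p \<in> C \<and> Q p. F (pt K p))"
  by (rule sum.reindex_bij_witness[where j = "cut_at K s" and i = "pt K"])
    (use cut_at_crossing cut_at_pt crossing_of_passage subset in auto)

lemma sum_crossings_transits:
  "(\<Sum>v | v \<in> X \<and> Q (transit_at K s v). F v) = (\<Sum>p | p \<in> T \<and> Q p. F (pt K p))"
  by (rule sum.reindex_bij_witness[where j = "transit_at K s" and i = "pt K"])
    (use transit_at_crossing transit_at_pt crossing_of_passage transits_subset in auto)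

lemma finite_crossings: "finite X"
  unfolding crossings_def using finite_marks by simp

text \<open>The change of color along the orientation that the red values prescribe; the opposite
  signs on the two strands encode conservation at the crossing.\<close>

definition jump :: "(cell \<Rightarrow> int) \<Rightarrow> point \<Rightarrow> int" where
  "jump f p = (if p \<in> C then - f (Red (pt K p)) else f (Red (pt K p)))"

lemma sum_jump:
  "(\<Sum>p | p \<in> P \<and> Q p. jump f p)
    = (\<Sum>p | p \<in> T \<and> Q p. f (Red (pt K p))) - (\<Sum>p | p \<in> C \<and> Q p. f (Red (pt K p)))"
proof -
  have "{p \<in> P. Q p} = {p \<in> T. Q p} \<union> {p \<in> C. Q p}"
    using cuts_Un_transits by blast
  moreover have "{p \<in> T. Q p} \<inter> {p \<in> C. Q p} = {}"
    using cuts_Int_transits by blast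
  moreover have "finite {p \<in> T. Q p}" "finite {p \<in> C. Q p}"
    using finite_subset[OF transits_subset finite_marks] sub.finite_marks by simp_all
  moreover have "(\<Sum>p\<in>{p \<in> T. Q p}. jump f p) = (\<Sum>p | p \<in> T \<and> Q p. f (Red (pt K p)))"
    by (rule sum.cong) (use cuts_Int_transits in \<open>auto simp: jump_def\<close>)
  moreover have "(\<Sum>p\<in>{p \<in> C. Q p}. jump f p) = - (\<Sum>p | p \<in> C \<and> Q p. f (Red (pt K p)))"
    by (simp add: jump_def sum_negf)
  ultimately show ?thesis
    by (simp add: sum.union_disjoint)
qed

lemma circles_iff: "i \<in> circles K s \<longleftrightarrow> i < ncomp K \<and> (\<forall>p\<in>C. fst p \<noteq> i)"
  by (auto simp: circles_def arc_graph_def pieces_def)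

text \<open>The blue edge comes from the crossing where the arc starts, the red ones from the
  crossings it transits. A transit lies on the arc iff its preceding cut is the start of the arc;
  \<open>next_in_prev_in\<close> then supplies the matching end.\<close>

lemma in_arcs_arc:
  assumes x: "x \<in> C"
  shows "in_arcs (arc_graph K s) (piece_to C x) = insert (Blue (pt K (prev_in C x)))
    (Red ` {v \<in> X. fst (transit_at K s v) = fst x \<and>
      prev_in C (transit_at K s v) = prev_in C x})"
proof -
  have blue: "piece_from C (cut_at K s v) = piece_to C x \<longleftrightarrow> v = pt K (prev_in C x)"
    if v: "v \<in> X" for v
    using cut_at_crossing[OF v] cut_at_pt[OF sub.prev_in_mem(1)[OF x]] sub.next_prev[OF x]
    by (auto simp: piece_from_def piece_to_def)
  have red: "piece_through C (transit_at K s v) = piece_to C x \<longleftrightarrow>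
      fst (transit_at K s v) = fst x \<and> prev_in C (transit_at K s v) = prev_in C x"
    if v: "v \<in> X" for v
  proof -
    let ?t = "transit_at K s v"
    have t: "?t \<in> P" "?t \<notin> C"
      using transit_at_crossing[OF v] transits_subset cuts_Int_transits by auto
    show ?thesis
    proof
      assume eq: "piece_through C ?t = piece_to C x"
      then obtain r where r: "r \<in> C" "fst r = fst ?t"
        by (auto simp: piece_through_def piece_to_def split: if_splits)
      then have "prev_in C ?t = prev_in C x"
        using eq by (auto simp: piece_through_def piece_to_def split: if_splits)
      moreover have "fst (prev_in C ?t) = fst ?t"
        by (rule sub.prev_in_minimal(2)[OF r marks_range[OF t(1)]])
      ultimately show "fst ?t = fst x \<and> prev_in C ?t = prev_in C x"
        using sub.prev_in_mem(2)[OF x] by simp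
    next
      assume eq: "fst ?t = fst x \<and> prev_in C ?t = prev_in C x"
      then have "next_in C (prev_in C ?t) = next_in C ?t"
        using next_in_prev_in[OF t x] by simp
      then have "next_in C ?t = x"
        using eq sub.next_prev[OF x] by simp
      then show "piece_through C ?t = piece_to C x"
        using eq x by (auto simp: piece_through_def piece_to_def)
    qed
  qed
  have "pt K (prev_in C x) \<in> X"
    using sub.prev_in_mem(1)[OF x] subset crossing_of_passage by blast
  then show ?thesis
    using blue red by (auto simp: in_arcs_def arc_graph_def)
qed

lemma in_arcs_circle:
  assumes "i \<in> circles K s"
  shows "in_arcs (arc_graph K s) (Circle i) = Red ` {v \<in> X. fst (transit_at K s v) = i}"
proof -
  have "piece_through C p = Circle i \<longleftrightarrow> fst p = i" for p
    using assms circles_iff by (auto simp only: piece_through_def split: if_splits)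
  then have "cell_head K s (Red v) = Circle i \<longleftrightarrow> fst (transit_at K s v) = i" for v
    by simp
  moreover have "cell_head K s (Blue v) \<noteq> Circle i" for v
    by (simp add: piece_from_def)
  ultimately show ?thesis
    unfolding in_arcs_def arc_graph_def pre_digraph.simps by blast
qed

text \<open>The last summand corrects for \<open>x\<close>: the range of the jump sum contains the
  end of the arc, which contributes \<open>- f (Red (pt K x))\<close> although its red edge leaves
  the arc.\<close>

lemma sum_in_arcs_arc:
  assumes x: "x \<in> C"
  shows "(\<Sum>e\<in>in_arcs (arc_graph K s) (piece_to C x). f e) = f (Blue (pt K (prev_in C x)))
    + (\<Sum>p | p \<in> P \<and> fst p = fst x \<and> prev_in C p = prev_in C x. jump f p) + f (Red (pt K x))"
proof -
  let ?Q = "\<lambda>p. fst p = fst x \<and> prev_in C p = prev_in C x"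
  have "p = x" if "p \<in> C" "?Q p" for p
    using sub.next_prev[OF that(1)] sub.next_prev[OF x] that(2) by metis
  then have "{p \<in> C. ?Q p} = {x}"
    using x by auto
  moreover have "(\<Sum>e\<in>Red ` {v \<in> X. ?Q (transit_at K s v)}. f e)
      = (\<Sum>v | v \<in> X \<and> ?Q (transit_at K s v). f (Red v))"
    by (simp add: sum.reindex inj_on_def)
  moreover have "Blue (pt K (prev_in C x)) \<notin> Red ` {v \<in> X. ?Q (transit_at K s v)}"
    by auto
  ultimately show ?thesis
    unfolding in_arcs_arc[OF x] sum_jump sum_crossings_transits
    using finite_crossings by (simp add: sum_crossings_transits[where Q = ?Q])
qed

text \<open>The red value at the end of an arc cancels against the one in f(v), leaving only blue
  values and jumps. The condition at a circle is absorbed by the component condition, since red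
  edges leave a component at its cuts and a circle has none.\<close>

lemma arc_flows_iff:
  "f \<in> arc_flows K s c \<longleftrightarrow> f \<in> extensional (flow_domain K s c) \<and>
    (\<forall>x\<in>C. f (Blue (pt K x)) = f (Blue (pt K (prev_in C x)))
      + (\<Sum>p | p \<in> P \<and> fst p = fst x \<and> prev_in C p = prev_in C x. jump f p)) \<and>
    (\<forall>i<ncomp K. (\<Sum>p | p \<in> P \<and> fst p = i. jump f p) = 0)"
proof -
  have arcs: "(\<forall>v\<in>X. (\<Sum>e\<in>in_arcs (arc_graph K s) (piece_to C (cut_at K s v)). f e)
        = f (Blue v) + f (Red v)) \<longleftrightarrow>
      (\<forall>x\<in>C. f (Blue (pt K x)) = f (Blue (pt K (prev_in C x)))
        + (\<Sum>p | p \<in> P \<and> fst p = fst x \<and> prev_in C p = prev_in C x. jump f p))"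
    unfolding ball_crossings_cuts
    by (intro ball_cong refl) (auto simp: cut_at_pt sum_in_arcs_arc)
  have circ: "(\<Sum>e\<in>in_arcs (arc_graph K s) (Circle i). f e)
      = (\<Sum>p | p \<in> P \<and> fst p = i. jump f p)" if "i \<in> circles K s" for i
  proof -
    have "{p \<in> C. fst p = i} = {}"
      using that circles_iff by blast
    then have "(\<Sum>p | p \<in> C \<and> fst p = i. f (Red (pt K p))) = 0"
      by (simp only: sum.empty)
    moreover have "(\<Sum>e\<in>Red ` {v \<in> X. fst (transit_at K s v) = i}. f e)
        = (\<Sum>v | v \<in> X \<and> fst (transit_at K s v) = i. f (Red v))"
      by (simp add: sum.reindex inj_on_def)
    ultimately show ?thesis
      unfolding in_arcs_circle[OF that] sum_jump
      by (simp add: sum_crossings_transits[where Q = "\<lambda>p. fst p = i"])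
  qed
  have comp: "(\<Sum>e | e \<in> Red ` X \<and> component (head (arc_graph K s) e) = i. f e)
      - (\<Sum>e | e \<in> Red ` X \<and> component (tail (arc_graph K s) e) = i. f e)
      = (\<Sum>p | p \<in> P \<and> fst p = i. jump f p)" if "i < ncomp K" for i
  proof -
    have "component (head (arc_graph K s) (Red v)) = fst (transit_at K s v)" if v: "v \<in> X" for v
    proof -
      have "transit_at K s v \<in> P"
        using transit_at_crossing(1)[OF v] transits_subset by blast
      then have "fst (prev_in C (transit_at K s v)) = fst (transit_at K s v)"
        if "r \<in> C" "fst r = fst (transit_at K s v)" for r
        using sub.prev_in_minimal(2)[OF that marks_range] by blast
      then show ?thesis
        by (auto simp only: arc_graph_def piece_through_def cell_head.simps component.simps
            pre_digraph.simps split: if_split)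
    qed
    then have "{e. e \<in> Red ` X \<and> component (head (arc_graph K s) e) = i}
        = Red ` {v \<in> X. fst (transit_at K s v) = i}"
      by auto
    moreover have "component (tail (arc_graph K s) (Red v)) = fst (cut_at K s v)" if "v \<in> X" for v
      using cut_at_crossing(1)[OF that] by (simp add: arc_graph_def piece_to_def)
    then have "{e. e \<in> Red ` X \<and> component (tail (arc_graph K s) e) = i}
        = Red ` {v \<in> X. fst (cut_at K s v) = i}"
      by auto
    ultimately show ?thesis
      by (simp add: sum.reindex inj_on_def sum_jump
          sum_crossings_transits[where Q = "\<lambda>p. fst p = i"] sum_crossings_cuts[where Q = "\<lambda>p. fst p = i"])
  qed
  have "i < ncomp K" if "i \<in> circles K s" for i
    using that circles_iff by blast
  then show ?thesis
    unfolding arc_flows_def mem_Collect_eq arcs using circ comp by auto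
qed

section \<open>Part arcs, their flows, and the correspondence in terms of jumps\<close>

lemma color_in_eq: "p \<in> P \<Longrightarrow> col_in g p = col_out g (prev_in P p)"
  by (simp add: piece_to_def piece_from_def)

lemma part_arcs_cases:
  assumes "a \<in> part_arcs K"
  obtains p where "p \<in> P" "a = piece_from P p"
  | i where "i < ncomp K" "\<forall>p\<in>P. fst p \<noteq> i" "a = Circle i"
  using assms unfolding part_arcs_def pieces_def piece_from_def by blast

lemma piece_from_part_arc: "p \<in> P \<Longrightarrow> piece_from P p \<in> part_arcs K"
  unfolding part_arcs_def pieces_def piece_from_def by blast

lemma piece_to_part_arc: "p \<in> P \<Longrightarrow> piece_to P p \<in> part_arcs K"
  using piece_from_part_arc[of "prev_in P p"] by (simp add: piece_to_def piece_from_def)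

lemma chosen_circle:
  assumes "i \<in> circles K s" "\<forall>p\<in>P. fst p \<noteq> i"
  shows "c i = Circle i"
proof -
  have "c i \<in> part_arcs K" "component (c i) = i"
    using choice assms(1) unfolding choice_of_part_arcs_def by blast+
  then show ?thesis
    using assms(2) by (cases rule: part_arcs_cases) (auto simp: piece_from_def)
qed

lemma chosen_arc:
  assumes "i \<in> circles K s" "p \<in> P" "fst p = i"
  obtains q where "q \<in> P" "fst q = i" "c i = piece_from P q"
proof -
  have "c i \<in> part_arcs K" "component (c i) = i"
    using choice assms(1) unfolding choice_of_part_arcs_def by blast+
  then show ?thesis
    using assms(2,3) that by (cases rule: part_arcs_cases) (auto simp: piece_from_def)
qed

lemma part_flows_iff:
  "g \<in> part_flows K \<longleftrightarrow> g \<in> extensional (part_arcs K) \<and>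
    (\<forall>v\<in>X. col_in g (cut_at K s v) + col_in g (transit_at K s v)
      = col_out g (cut_at K s v) + col_out g (transit_at K s v))"
proof -
  have "(\<Sum>a\<in>in_arcs (part_graph K) v. g a) = col_in g (cut_at K s v) + col_in g (transit_at K s v)"
      "(\<Sum>a\<in>out_arcs (part_graph K) v. g a) = col_out g (cut_at K s v) + col_out g (transit_at K s v)"
    if v: "v \<in> X" for v
  proof -
    let ?c = "cut_at K s v" and ?t = "transit_at K s v"
    note ct = cut_at_crossing[OF v] transit_at_crossing[OF v]
    have mem: "?c \<in> P" "?t \<in> P" "?c \<noteq> ?t"
      using ct subset transits_subset cuts_Int_transits by auto
    have only: "p = ?c \<or> p = ?t" if "p \<in> P" "pt K p = v" for p
      using that cuts_Un_transits cut_at_pt transit_at_pt by (metis UnE)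
    have arc: "a \<in> arcs (part_graph K) \<longleftrightarrow> (\<exists>p\<in>P. a = piece_from P p)" for a
      by (auto simp: part_graph_def part_arcs_def pieces_def piece_from_def)
    have "in_arcs (part_graph K) v = {piece_to P ?c, piece_to P ?t}"
    proof (intro equalityI subsetI)
      fix a assume "a \<in> in_arcs (part_graph K) v"
      then have "a \<in> arcs (part_graph K)" "pt K (stop a) = v"
        by (simp_all add: in_arcs_def part_graph_def)
      then obtain p where p: "p \<in> P" "a = piece_from P p" "pt K (stop a) = v"
        using arc by blast
      have "a = piece_to P (next_in P p)" "next_in P p \<in> P" "pt K (next_in P p) = v"
        using p by (simp_all add: piece_to_def piece_from_def)
      then show "a \<in> {piece_to P ?c, piece_to P ?t}"
        using only[of "next_in P p"] by (metis insertI1 insertI2)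
    next
      fix a assume "a \<in> {piece_to P ?c, piece_to P ?t}"
      then have "\<exists>p\<in>P. a = piece_to P p \<and> pt K p = v"
        using mem ct by blast
      then obtain p where "p \<in> P" "a = piece_to P p" "pt K p = v"
        by blast
      then have "a = piece_from P (prev_in P p)" "prev_in P p \<in> P" "pt K (stop a) = v"
        by (simp_all add: piece_to_def piece_from_def)
      then have "a \<in> arcs (part_graph K)" "pt K (stop a) = v"
        using arc by blast+
      then show "a \<in> in_arcs (part_graph K) v"
        by (simp add: in_arcs_def part_graph_def)
    qed
    moreover have "out_arcs (part_graph K) v = {piece_from P ?c, piece_from P ?t}"
    proof (intro equalityI subsetI)
      fix a assume "a \<in> out_arcs (part_graph K) v"
      then have "a \<in> arcs (part_graph K)" "pt K (start a) = v"
        by (simp_all add: out_arcs_def part_graph_def)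
      then obtain p where p: "p \<in> P" "a = piece_from P p" "pt K (start a) = v"
        using arc by blast
      then have "pt K p = v"
        by (simp add: piece_from_def)
      then show "a \<in> {piece_from P ?c, piece_from P ?t}"
        using only[of p] p(1,2) by (metis insertI1 insertI2)
    next
      fix a assume "a \<in> {piece_from P ?c, piece_from P ?t}"
      then have "\<exists>p\<in>P. a = piece_from P p \<and> pt K p = v"
        using mem ct by blast
      then have "a \<in> arcs (part_graph K)" "pt K (start a) = v"
        using arc by (blast, metis piece.sel(1) piece_from_def)
      then show "a \<in> out_arcs (part_graph K) v"
        by (simp add: out_arcs_def part_graph_def)
    qed
    \<comment> \<open>Distinctness keeps the sums over these sets from merging two summands.\<close>
    moreover have "piece_to P ?c \<noteq> piece_to P ?t" "piece_from P ?c \<noteq> piece_from P ?t"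
      using mem(3) by (simp_all add: piece_to_def piece_from_def)
    ultimately show
      "(\<Sum>a\<in>in_arcs (part_graph K) v. g a) = col_in g ?c + col_in g ?t"
      "(\<Sum>a\<in>out_arcs (part_graph K) v. g a) = col_out g ?c + col_out g ?t"
      by simp_all
  qed
  moreover have "verts (part_graph K) = X"
    by (simp add: part_graph_def)
  ultimately show ?thesis
    unfolding part_flows_def by simp
qed

text \<open>The equations for the two strands fuse into a single recursion over all passages,
  because the incoming color is the color that leaves the preceding passage.\<close>

lemma corresponds_iff:
  "corresponds K s c f g \<longleftrightarrow>
    (\<forall>p\<in>P. col_out g p = col_out g (prev_in P p) + jump f p) \<and>
    (\<forall>p\<in>C. col_out g p = f (Blue (pt K p))) \<and>
    (\<forall>i\<in>circles K s. g (c i) = f (Chosen (c i)))"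
proof -
  have cut: "(\<forall>v\<in>X. col_out g (cut_at K s v) = col_in g (cut_at K s v) - f (Red v))
      \<longleftrightarrow> (\<forall>p\<in>C. col_out g p = col_out g (prev_in P p) + jump f p)"
    unfolding ball_crossings_cuts
  proof (rule ball_cong[OF refl])
    fix p assume "p \<in> C"
    moreover have "p \<in> P"
      using \<open>p \<in> C\<close> subset by blast
    ultimately show "(col_out g (cut_at K s (pt K p)) = col_in g (cut_at K s (pt K p)) - f (Red (pt K p)))
        = (col_out g p = col_out g (prev_in P p) + jump f p)"
      unfolding jump_def using color_in_eq[of p g] cut_at_pt[of p] by simp
  qed
  have transit: "(\<forall>v\<in>X. col_out g (transit_at K s v) = col_in g (transit_at K s v) + f (Red v))
      \<longleftrightarrow> (\<forall>p\<in>T. col_out g p = col_out g (prev_in P p) + jump f p)"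
    unfolding ball_crossings_transits
  proof (rule ball_cong[OF refl])
    fix p assume "p \<in> T"
    moreover have "p \<notin> C" "p \<in> P"
      using \<open>p \<in> T\<close> cuts_Int_transits transits_subset by blast+
    ultimately show "(col_out g (transit_at K s (pt K p)) =
        col_in g (transit_at K s (pt K p)) + f (Red (pt K p)))
        = (col_out g p = col_out g (prev_in P p) + jump f p)"
      unfolding jump_def using color_in_eq[of p g] transit_at_pt[of p] by simp
  qed
  have blue: "(\<forall>v\<in>X. col_out g (cut_at K s v) = f (Blue v))
      \<longleftrightarrow> (\<forall>p\<in>C. col_out g p = f (Blue (pt K p)))"
    unfolding ball_crossings_cuts by (rule ball_cong) (simp_all add: cut_at_pt)
  have "(\<forall>p\<in>P. col_out g p = col_out g (prev_in P p) + jump f p) \<longleftrightarrow>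
      (\<forall>p\<in>C. col_out g p = col_out g (prev_in P p) + jump f p) \<and>
      (\<forall>p\<in>T. col_out g p = col_out g (prev_in P p) + jump f p)"
    using cuts_Un_transits by (metis UnE UnI1 UnI2)
  then show ?thesis
    unfolding corresponds_def ball_conj_distrib cut transit blue by argo
qed

lemma corresponds_jump:
  "corresponds K s c f g \<Longrightarrow> p \<in> P \<Longrightarrow> col_out g p = col_out g (prev_in P p) + jump f p"
  unfolding corresponds_iff by blast

lemma corresponds_blue: "corresponds K s c f g \<Longrightarrow> p \<in> C \<Longrightarrow> col_out g p = f (Blue (pt K p))"
  unfolding corresponds_iff by blast

lemma corresponds_chosen:
  "corresponds K s c f g \<Longrightarrow> i \<in> circles K s \<Longrightarrow> g (c i) = f (Chosen (c i))"
  unfolding corresponds_iff by blast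

section \<open>The bijection\<close>

text \<open>The jumps are differences of one function on passages, so they telescope between
  consecutive cuts and around each component.\<close>

lemma corresponds_arc_flow:
  assumes "corresponds K s c f g" "f \<in> extensional (flow_domain K s c)"
  shows "f \<in> arc_flows K s c"
proof -
  have jump: "jump f p = col_out g p - col_out g (prev_in P p)" if "p \<in> P" for p
    using corresponds_jump[OF assms(1) that] by simp
  have "f (Blue (pt K x)) = f (Blue (pt K (prev_in C x)))
      + (\<Sum>p | p \<in> P \<and> fst p = fst x \<and> prev_in C p = prev_in C x. jump f p)" if x: "x \<in> C" for x
    using sum_between[OF x, of "col_out g"] corresponds_blue[OF assms(1)] x
      sub.prev_in_mem(1)[OF x] by (simp add: jump)
  moreover have "(\<Sum>p | p \<in> P \<and> fst p = i. jump f p) = 0" for i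
    using sum_circle[of "col_out g" i] by (simp add: jump)
  ultimately show ?thesis
    unfolding arc_flows_iff using assms(2) by blast
qed

lemma corresponds_part_flow:
  assumes "corresponds K s c f g" "g \<in> extensional (part_arcs K)"
  shows "g \<in> part_flows K"
  unfolding part_flows_iff
proof (intro conjI ballI)
  fix v assume "v \<in> X"
  then have "col_out g (cut_at K s v) = col_in g (cut_at K s v) - f (Red v)"
    "col_out g (transit_at K s v) = col_in g (transit_at K s v) + f (Red v)"
    using assms(1) unfolding corresponds_def by blast+
  then show "col_in g (cut_at K s v) + col_in g (transit_at K s v)
      = col_out g (cut_at K s v) + col_out g (transit_at K s v)"
    by linarith
qed (rule assms(2))

text \<open>All values of \<open>f\<close> are forced by \<open>g\<close> on the cut strands and the
  chosen arcs; the equation on the other strand is then conservation at the crossing.\<close>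

lemma ex_arc_flow:
  assumes "g \<in> part_flows K"
  shows "\<exists>f\<in>extensional (flow_domain K s c). corresponds K s c f g"
proof
  define f where "f = restrict (\<lambda>e. case e of Blue v \<Rightarrow> col_out g (cut_at K s v)
    | Red v \<Rightarrow> col_in g (cut_at K s v) - col_out g (cut_at K s v)
    | Chosen a \<Rightarrow> g a) (flow_domain K s c)"
  show "f \<in> extensional (flow_domain K s c)"
    unfolding f_def by simp
  have f: "f (Blue v) = col_out g (cut_at K s v)"
    "f (Red v) = col_in g (cut_at K s v) - col_out g (cut_at K s v)" if "v \<in> X" for v
    using that by (simp_all add: f_def flow_domain_def arc_graph_def)
  have "g (c i) = f (Chosen (c i))" if "i \<in> circles K s" for i
    using that by (simp add: f_def flow_domain_def)
  moreover have "col_out g (cut_at K s v) = f (Blue v) \<and>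
      col_out g (cut_at K s v) = col_in g (cut_at K s v) - f (Red v) \<and>
      col_out g (transit_at K s v) = col_in g (transit_at K s v) + f (Red v)" if v: "v \<in> X" for v
  proof -
    have "col_in g (cut_at K s v) + col_in g (transit_at K s v)
        = col_out g (cut_at K s v) + col_out g (transit_at K s v)"
      using assms v unfolding part_flows_iff by blast
    then show ?thesis
      using f[OF v] by linarith
  qed
  ultimately show "corresponds K s c f g"
    unfolding corresponds_def by blast
qed

lemma arc_flow_unique:
  assumes "corresponds K s c f g" "corresponds K s c f' g"
    and "f \<in> extensional (flow_domain K s c)" "f' \<in> extensional (flow_domain K s c)"
  shows "f = f'"
proof (rule extensionalityI[OF assms(3,4)])
  fix e assume "e \<in> flow_domain K s c"
  then consider v where "v \<in> X" "e = Blue v" | v where "v \<in> X" "e = Red v"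
    | i where "i \<in> circles K s" "e = Chosen (c i)"
    unfolding flow_domain_def arc_graph_def by auto
  then show "f e = f' e"
    using assms(1,2) unfolding corresponds_def by cases fastforce+
qed

text \<open>Two colorings with the same jumps differ by a constant on each component, and every
  component carries a prescribed color.\<close>

lemma part_flow_unique:
  assumes "corresponds K s c f g" "corresponds K s c f g'"
    and "g \<in> extensional (part_arcs K)" "g' \<in> extensional (part_arcs K)"
  shows "g = g'"
proof (rule extensionalityI[OF assms(3,4)])
  fix a assume "a \<in> part_arcs K"
  then show "g a = g' a"
  proof (cases rule: part_arcs_cases)
    case (1 p)
    have step: "col_out g (prev_in P q) = col_out g' (prev_in P q)"
      if "q \<in> P" "col_out g q = col_out g' q" for q
      using corresponds_jump[OF assms(1) that(1)] corresponds_jump[OF assms(2) that(1)] that(2)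
      by simp
    obtain q where "q \<in> P" "fst p = fst q" "col_out g q = col_out g' q"
    proof (cases "fst p \<in> circles K s")
      case True
      then obtain q where "q \<in> P" "fst q = fst p" "c (fst p) = piece_from P q"
        using chosen_arc 1(1) by blast
      then show ?thesis
        using that corresponds_chosen[OF assms(1) True] corresponds_chosen[OF assms(2) True] by simp
    next
      case False
      then obtain q where "q \<in> C" "fst q = fst p"
        using circles_iff fst_less_ncomp[OF 1(1)] by auto
      then show ?thesis
        using that[of q] corresponds_blue[OF assms(1)] corresponds_blue[OF assms(2)] subset by auto
    qed
    then have "col_out g p = col_out g' p"
      using prev_in_cyclic[of q "\<lambda>q. col_out g q = col_out g' q" p] step 1(1) by metis
    then show ?thesis
      using 1 by simp
  next
    case (2 i)
    then have i: "i \<in> circles K s"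
      using circles_iff subset by blast
    have "c i = a"
      using chosen_circle[OF i] 2 by simp
    then show ?thesis
      using corresponds_chosen[OF assms(1) i] corresponds_chosen[OF assms(2) i] by simp
  qed
qed

text \<open>A potential \<open>h\<close> of the jumps is corrected by a constant on each component.
  Agreement with the blue value is arranged at one cut only; telescoping against the flow condition
  carries it to the other cuts.\<close>

lemma ex_part_flow:
  assumes "f \<in> arc_flows K s c"
  shows "\<exists>g\<in>extensional (part_arcs K). corresponds K s c f g"
proof -
  have arc: "f (Blue (pt K x)) = f (Blue (pt K (prev_in C x)))
      + (\<Sum>p | p \<in> P \<and> fst p = fst x \<and> prev_in C p = prev_in C x. jump f p)" if "x \<in> C" for x
    using assms that unfolding arc_flows_iff by blast
  have "(\<Sum>p | p \<in> P \<and> fst p = i. jump f p) = 0" for i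
  proof (cases "i < ncomp K")
    case True
    then show ?thesis
      using assms unfolding arc_flows_iff by blast
  next
    case False
    then have "{p \<in> P. fst p = i} = {}"
      using fst_less_ncomp by blast
    then show ?thesis
      by (simp only: sum.empty)
  qed
  then obtain h where h: "\<And>p. p \<in> P \<Longrightarrow> h p = h (prev_in P p) + jump f p"
    using potential_exists by blast
  \<comment> \<open>The correction that gives the chosen part arc, or else the part arc leaving some
    cut \<open>x\<close>, its prescribed color.\<close>
  define k where "k i = (if i \<in> circles K s then f (Chosen (c i)) - h (start (c i))
    else let x = SOME x. x \<in> C \<and> fst x = i in f (Blue (pt K x)) - h x)" for i
  \<comment> \<open>A closed part arc is the whole of its component, so it is the chosen one
    there.\<close>
  define g where "g = restrict (\<lambda>a. case a of Arc p q \<Rightarrow> h p + k (fst p)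
    | Circle i \<Rightarrow> f (Chosen (Circle i))) (part_arcs K)"
  have out: "col_out g p = h p + k (fst p)" if "p \<in> P" for p
    using piece_from_part_arc[OF that] by (simp add: g_def piece_from_def)
  have jump: "col_out g p = col_out g (prev_in P p) + jump f p" if "p \<in> P" for p
    using out[OF that] out[OF prev_in_mem(1)[OF that]] h[OF that] that by simp
  have blue: "col_out g p = f (Blue (pt K p))" if p: "p \<in> C" for p
  proof -
    let ?Q = "\<lambda>p. col_out g p = f (Blue (pt K p))"
    define x where "x = (SOME x. x \<in> C \<and> fst x = fst p)"
    have x: "x \<in> C" "fst x = fst p"
      using someI[of "\<lambda>x. x \<in> C \<and> fst x = fst p" p] p unfolding x_def by simp_all
    have "fst p \<notin> circles K s"
      using p circles_iff by blast
    then have "k (fst p) = f (Blue (pt K x)) - h x"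
      by (simp add: k_def x_def Let_def)
    moreover have "x \<in> P"
      using x subset by blast
    ultimately have "?Q x"
      using out x(2) by simp
    moreover have "?Q (prev_in C q)" if q: "q \<in> C" "?Q q" for q
    proof -
      have "jump f p = col_out g p - col_out g (prev_in P p)" if "p \<in> P" for p
        using jump[OF that] by simp
      then show ?thesis
        using sum_between[OF q(1), of "col_out g"] arc[OF q(1)] q(2) by simp
    qed
    ultimately show ?thesis
      using sub.prev_in_cyclic[of x ?Q p] x p by metis
  qed
  have chosen: "g (c i) = f (Chosen (c i))" if i: "i \<in> circles K s" for i
  proof (cases "\<exists>p\<in>P. fst p = i")
    case True
    then obtain q where q: "q \<in> P" "fst q = i" "c i = piece_from P q"
      using chosen_arc[OF i] by blast
    then have "k i = f (Chosen (c i)) - h q"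
      using i by (simp add: k_def piece_from_def)
    then show ?thesis
      using out[OF q(1)] q by simp
  next
    case False
    then have "c i = Circle i"
      using chosen_circle[OF i] by blast
    moreover have "c i \<in> part_arcs K"
      using choice i unfolding choice_of_part_arcs_def by blast
    ultimately show ?thesis
      by (simp add: g_def)
  qed
  have "corresponds K s c f g"
    unfolding corresponds_iff using jump blue chosen by blast
  moreover have "g \<in> extensional (part_arcs K)"
    unfolding g_def by simp
  ultimately show ?thesis
    by blast
qed

section \<open>Bounded flows\<close>

text \<open>For \<open>Pos\<close> the overstrand is the transit and gains the red value, for
  \<open>Neg\<close> it is the cut strand and loses it; the two monotonicity conditions thus both
  ask for nonnegative red values.\<close>

lemma over_monotone_iff:
  assumes corr: "corresponds K s c f g"
  shows "(\<forall>p\<in>over K. case s of Pos \<Rightarrow> col_in g p \<le> col_out g p | Neg \<Rightarrow> col_out g p \<le> col_in g p)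
    \<longleftrightarrow> (\<forall>v\<in>X. f (Red v) \<ge> 0)"
proof -
  have step: "col_out g p = col_in g p + jump f p" if "p \<in> P" for p
    using corresponds_jump[OF corr that] color_in_eq[OF that, of g] by simp
  show ?thesis
  proof (cases s)
    case Pos
    then have T: "over K = T"
      by simp
    have "(col_in g p \<le> col_out g p) = (f (Red (pt K p)) \<ge> 0)" if "p \<in> T" for p
    proof -
      have "p \<in> P" "p \<notin> C"
        using that transits_subset cuts_Int_transits by auto
      then show ?thesis
        using step[of p] by (simp add: jump_def)
    qed
    then show ?thesis
      unfolding ball_crossings_transits T using Pos by simp
  next
    case Neg
    then have C: "over K = C"
      by simp
    have "(col_out g p \<le> col_in g p) = (f (Red (pt K p)) \<ge> 0)" if "p \<in> C" for p
    proof -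
      have "p \<in> P"
        using that subset by auto
      then show ?thesis
        using step[of p] that by (simp add: jump_def)
    qed
    then show ?thesis
      unfolding ball_crossings_cuts C using Neg by simp
  qed
qed

text \<open>f(v) is the color of the part arc that enters \<open>v\<close> on the cut strand, which
  gives the bound on f(v).\<close>

lemma bounded_imp_bounded_arc:
  assumes corr: "corresponds K s c f g" and f: "f \<in> arc_flows K s c"
    and g: "\<forall>a\<in>part_arcs K. g a \<in> {0..n}" and mono: "\<forall>v\<in>X. f (Red v) \<ge> 0"
  shows "f \<in> bounded_arc_flows K s c n"
proof -
  have cross: "f (Blue v) \<in> {0..n}" "f (Red v) \<in> {0..n}" "f (Blue v) + f (Red v) \<le> n"
    if v: "v \<in> X" for v
  proof -
    have "cut_at K s v \<in> P"
      using cut_at_crossing(1)[OF v] subset by blast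
    then have "col_in g (cut_at K s v) \<in> {0..n}" "col_out g (cut_at K s v) \<in> {0..n}"
      using g piece_to_part_arc piece_from_part_arc by blast+
    moreover have "f (Blue v) = col_out g (cut_at K s v)"
      "f (Red v) = col_in g (cut_at K s v) - col_out g (cut_at K s v)"
      using corr v unfolding corresponds_def by auto
    moreover have "f (Red v) \<ge> 0"
      using mono v by blast
    ultimately show "f (Blue v) \<in> {0..n}" "f (Red v) \<in> {0..n}" "f (Blue v) + f (Red v) \<le> n"
      by auto
  qed
  moreover have "f (Chosen (c i)) \<in> {0..n}" if "i \<in> circles K s" for i
    using corresponds_chosen[OF corr that] g choice that
    unfolding choice_of_part_arcs_def by metis
  ultimately show ?thesis
    using f unfolding bounded_arc_flows_def flow_domain_def arc_graph_def by auto
qed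

text \<open>Along an arc the color increases from a blue value to \<open>f(v)\<close>; along a circle it increases
  weakly, hence is constant.\<close>

lemma bounded_imp_bounded_part:
  assumes corr: "corresponds K s c f g" and f: "f \<in> bounded_arc_flows K s c n"
    and a: "a \<in> part_arcs K"
  shows "g a \<in> {0..n}"
proof -
  have blue: "f (Blue v) \<ge> 0" and red: "f (Red v) \<ge> 0" and total: "f (Blue v) + f (Red v) \<le> n"
    if "v \<in> X" for v
    using f that unfolding bounded_arc_flows_def flow_domain_def arc_graph_def by auto
  have chosen: "f (Chosen (c i)) \<in> {0..n}" if "i \<in> circles K s" for i
    using f that unfolding bounded_arc_flows_def flow_domain_def by auto
  have incr: "col_out g (prev_in P p) \<le> col_out g p" if "p \<in> P" "p \<notin> C" for p
    using corresponds_jump[OF corr that(1)] red[OF crossing_of_passage[OF that(1)]] that(2)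
    by (simp add: jump_def)
  show ?thesis
    using a
  proof (cases rule: part_arcs_cases)
    case (1 p)
    show ?thesis
    proof (cases "fst p \<in> circles K s")
      case True
      obtain q where q: "q \<in> P" "fst q = fst p" "c (fst p) = piece_from P q"
        using chosen_arc[OF True 1(1)] by blast
      have noC: "r \<notin> C" if "fst r = fst p" for r
        using True that circles_iff by blast
      \<comment> \<open>Walking backwards from the chosen arc bounds every color from above, walking
        forwards from below. The conjunct on \<open>fst r\<close> is carried along to know that no
        visited passage is a cut.\<close>
      have "fst r = fst p \<and> col_out g r \<le> col_out g q" if "r \<in> P" "fst r = fst q" for r
      proof (rule prev_in_cyclic[OF q(1) _ _ that])
        show "fst q = fst p \<and> col_out g q \<le> col_out g q"
          using q by simp
        show "fst (prev_in P x) = fst p \<and> col_out g (prev_in P x) \<le> col_out g q"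
          if "x \<in> P" "fst x = fst p \<and> col_out g x \<le> col_out g q" for x
          using incr[OF that(1)] noC[of x] that by auto
      qed
      moreover have "fst r = fst p \<and> col_out g q \<le> col_out g r" if "r \<in> P" "fst r = fst q" for r
      proof (rule next_in_cyclic[OF q(1) _ _ that])
        show "fst q = fst p \<and> col_out g q \<le> col_out g q"
          using q by simp
        show "fst (next_in P x) = fst p \<and> col_out g q \<le> col_out g (next_in P x)"
          if "x \<in> P" "fst x = fst p \<and> col_out g q \<le> col_out g x" for x
          using incr[OF next_in_mem(1)[OF that(1)]] noC[of "next_in P x"] that by auto
      qed
      ultimately have "col_out g p = col_out g q"
        using 1(1) q(2) by (metis order_antisym)
      then show ?thesis
        using chosen[OF True] corresponds_chosen[OF corr True] q(3) 1(2) by simp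
    next
      case False
      then obtain x where x: "x \<in> C" "fst x = fst p"
        using circles_iff fst_less_ncomp[OF 1(1)] by auto
      then have xP: "x \<in> P"
        using subset by blast
      have low: "col_out g r \<ge> 0" if "r \<in> C" for r
        using corresponds_blue[OF corr that] blue[OF crossing_of_passage[of r]] that subset
        by auto
      have high: "col_out g (prev_in P r) \<le> n" if "r \<in> C" for r
        using corresponds_blue[OF corr that] corresponds_jump[OF corr, of r]
          total[OF crossing_of_passage, of r] that subset by (auto simp: jump_def)
      \<comment> \<open>A negative color cannot leave a cut, so it persists backwards past every
        passage and finally leaves the cut \<open>x\<close>.\<close>
      have "\<not> col_out g p < 0"
      proof
        assume neg: "col_out g p < 0"
        have "col_out g x < 0"
        proof (rule prev_in_cyclic[where Q = "\<lambda>r. col_out g r < 0", OF 1(1) neg _ xP x(2)])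
          show "col_out g (prev_in P r) < 0" if "r \<in> P" "col_out g r < 0" for r
            using incr[OF that(1)] low[of r] that(2) by linarith
        qed
        then show False
          using low[OF x(1)] by simp
      qed
      \<comment> \<open>A color above \<open>n\<close> cannot enter a cut, so it persists forwards
        until it enters \<open>x\<close>.\<close>
      moreover have "\<not> col_out g p > n"
      proof
        assume big: "col_out g p > n"
        have "col_out g (prev_in P x) > n"
        proof (rule next_in_cyclic[where Q = "\<lambda>r. n < col_out g r", OF 1(1) big])
          show "col_out g (next_in P r) > n" if "r \<in> P" "col_out g r > n" for r
            using incr[of "next_in P r"] high[of "next_in P r"] that
              next_in_mem(1)[OF that(1)] prev_next[OF that(1)] by fastforce
        qed (use xP x in simp_all)
        then show False
          using high[OF x(1)] by simp
      qed
      ultimately show ?thesis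
        using 1(2) by simp
    qed
  next
    case (2 i)
    then have i: "i \<in> circles K s"
      using circles_iff subset by blast
    have "c i = a"
      using chosen_circle[OF i] 2 by simp
    then show ?thesis
      using corresponds_chosen[OF corr i] chosen[OF i] by simp
  qed
qed

lemma bounded_iff:
  assumes corr: "corresponds K s c f g" and f: "f \<in> arc_flows K s c" and g: "g \<in> part_flows K"
  shows "f \<in> bounded_arc_flows K s c n \<longleftrightarrow> g \<in> bounded_part_flows K s n"
proof
  assume b: "f \<in> bounded_arc_flows K s c n"
  then have "\<forall>v\<in>X. f (Red v) \<ge> 0"
    unfolding bounded_arc_flows_def flow_domain_def arc_graph_def by auto
  then show "g \<in> bounded_part_flows K s n"
    unfolding bounded_part_flows_def
    using g bounded_imp_bounded_part[OF corr b] over_monotone_iff[OF corr] by blast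
next
  assume "g \<in> bounded_part_flows K s n"
  then show "f \<in> bounded_arc_flows K s c n"
    unfolding bounded_part_flows_def
    using bounded_imp_bounded_arc[OF corr f] over_monotone_iff[OF corr] by blast
qed

text \<open>Existence and uniqueness in both directions make \<open>corresponds\<close> the graph of
  a bijection; as the two bounds are equivalent on related pairs, the same map restricts for every
  \<open>n\<close>.\<close>

lemma flow_bijection:
  "\<exists>\<phi>. bij_betw \<phi> (arc_flows K s c) (part_flows K) \<and>
    (\<forall>f\<in>arc_flows K s c. \<forall>g\<in>extensional (part_arcs K). corresponds K s c f g \<longleftrightarrow> g = \<phi> f) \<and>
    (\<forall>n. bij_betw \<phi> (bounded_arc_flows K s c n) (bounded_part_flows K s n))"
proof -
  have ext: "f \<in> extensional (flow_domain K s c)" if "f \<in> arc_flows K s c" for f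
    using that unfolding arc_flows_def by blast
  obtain \<phi> where phi: "\<And>f. f \<in> arc_flows K s c \<Longrightarrow>
      \<phi> f \<in> extensional (part_arcs K) \<and> corresponds K s c f (\<phi> f)"
    using ex_part_flow by metis
  have char: "corresponds K s c f g \<longleftrightarrow> g = \<phi> f"
    if "f \<in> arc_flows K s c" "g \<in> extensional (part_arcs K)" for f g
    using part_flow_unique[of f g "\<phi> f"] phi that by blast
  have part: "\<phi> f \<in> part_flows K" if "f \<in> arc_flows K s c" for f
    using phi[OF that] corresponds_part_flow by blast
  have inj: "inj_on \<phi> (arc_flows K s c)"
    by (rule inj_onI) (metis phi ext arc_flow_unique)
  have surj: "\<exists>f\<in>arc_flows K s c. g = \<phi> f" if g: "g \<in> part_flows K" for g
  proof -
    obtain f where f: "f \<in> extensional (flow_domain K s c)" "corresponds K s c f g"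
      using ex_arc_flow[OF g] by blast
    have "g \<in> extensional (part_arcs K)"
      using g unfolding part_flows_def by blast
    then show ?thesis
      using char f corresponds_arc_flow[OF f(2,1)] by blast
  qed
  have bounded: "f \<in> bounded_arc_flows K s c n \<longleftrightarrow> \<phi> f \<in> bounded_part_flows K s n"
    if "f \<in> arc_flows K s c" for f n
    using bounded_iff[OF _ that part[OF that]] phi[OF that] by blast
  have sub: "bounded_arc_flows K s c n \<subseteq> arc_flows K s c"
    "bounded_part_flows K s n \<subseteq> part_flows K" for n
    unfolding bounded_arc_flows_def bounded_part_flows_def by blast+
  have "bij_betw \<phi> (arc_flows K s c) (part_flows K)"
    unfolding bij_betw_def using inj part surj by blast
  moreover have "bij_betw \<phi> (bounded_arc_flows K s c n) (bounded_part_flows K s n)" for n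
    unfolding bij_betw_def
  proof
    show "inj_on \<phi> (bounded_arc_flows K s c n)"
      using inj sub(1) by (rule inj_on_subset)
    show "\<phi> ` bounded_arc_flows K s c n = bounded_part_flows K s n"
    proof (intro equalityI subsetI)
      fix g assume "g \<in> \<phi> ` bounded_arc_flows K s c n"
      then show "g \<in> bounded_part_flows K s n"
        using bounded sub(1) by blast
    next
      fix g assume g: "g \<in> bounded_part_flows K s n"
      then obtain f where "f \<in> arc_flows K s c" "g = \<phi> f"
        using surj sub(2) by blast
      then show "g \<in> \<phi> ` bounded_arc_flows K s c n"
        using bounded g by blast
    qed
  qed
  ultimately show ?thesis
    using char by blast
qed

end

theorem lemma4p1:
  fixes K :: diagram and c :: "sign \<Rightarrow> nat \<Rightarrow> piece"
  assumes "Morse_projection K"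
    and "\<And>s. choice_of_part_arcs K s (c s)"
  shows "\<forall>s. \<exists>\<phi> :: (cell \<Rightarrow> int) \<Rightarrow> (piece \<Rightarrow> int).
           bij_betw \<phi> (arc_flows K s (c s)) (part_flows K) \<and>
           (\<forall>f\<in>arc_flows K s (c s). \<forall>g\<in>extensional (part_arcs K).
              corresponds K s (c s) f g \<longleftrightarrow> g = \<phi> f) \<and>
           (\<forall>n::int. n \<ge> 1 \<longrightarrow>
              bij_betw \<phi> (bounded_arc_flows K s (c s) n) (bounded_part_flows K s n))"
proof
  fix s
  interpret cut_diagram K s "c s"
    using assms by unfold_locales
  show "\<exists>\<phi> :: (cell \<Rightarrow> int) \<Rightarrow> (piece \<Rightarrow> int).
      bij_betw \<phi> (arc_flows K s (c s)) (part_flows K) \<and>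
      (\<forall>f\<in>arc_flows K s (c s). \<forall>g\<in>extensional (part_arcs K).
        corresponds K s (c s) f g \<longleftrightarrow> g = \<phi> f) \<and>
      (\<forall>n::int. n \<ge> 1 \<longrightarrow>
        bij_betw \<phi> (bounded_arc_flows K s (c s) n) (bounded_part_flows K s n))"
    using flow_bijection by blast
qed

end
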